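(* Let $\mathcal K$ be a closed convex cone, $s\in\mathcal K^*$, and let $\mathcal C_s=\{x\in\mathcal K:\langle s,x\rangle=0\}$ be the exposed face of $\mathcal K$ with defining vector $s$. Then $\mathcal C_s$ admits quadratic facial violation relative to $s$ in each of the following cases: 1. $\mathcal K=\{0\}^d$ or $\mathcal K=\mathbb R^d$; 2. $\mathcal K\subset \mathbb R^d$ is a proper cone and $\mathcal C_s$ is either $\{0\}^d$ or $\mathcal K$; 3. $\mathcal K=\mathbb R^d_+$ (any $s\in\mathcal K^*$); 4. $\mathcal K$ is a second-order cone $\mathcal K^d_{\rm SOC}$ (any $s\in\mathcal K^*$); 5. $\mathcal K$ is a positive semidefinite cone $\mathbb S^d_+$ (any $s\in\mathcal K^*$); 6. $\mathcal K$ is the exponential cone $\mathcal K^3_{\rm Exp}$ or its dual, and $s$ arises under strict complementarity, i.e. there is $x\in\mathcal K$ with $\langle x,s\rangle=0$, $x\in\operatorname{relint}(\mathcal C_s)$ and $s\in\operatorname{relint}(\mathcal C^*_x)$, where $\mathcal C^*_x=\{s'\in\mathcal K^*:\langle s',x\rangle=0\}$; 7. $\mathcal K$ is a power cone $\mathcal K^3_{\rm Pow}$ with parameter $p\in(0,1)$ or its dual, and $\mathcal C_s$ is a generic one-dimensional exposed face, meaning the following, where $\sigma=(\sigma_x,1-p,\sigma_z)$ with $\sigma_x>0$, $\sigma_z\neq0$, $(\sigma_x/p)^p=|\sigma_z|$: for $\mathcal K=\mathcal K^3_{\rm Pow}$, $s=\sigma$ for some such $\sigma$, so that $\mathcal C_s=\{t(\tfrac{p}{\sigma_x},1,-\tfrac1{\sigma_z}):t\ge0\}$;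 for $\mathcal K$ the dual power cone, $s=t(\tfrac{p}{\sigma_x},1,-\tfrac1{\sigma_z})$ for some such $\sigma$ and some $t>0$, so that $\mathcal C_s=\{t'\sigma:t'\ge0\}$. Moreover, the property is preserved under finite Cartesian products: if $\mathcal K=\mathcal K_1\times\dots\times\mathcal K_q$ and $s=(s_1,\dots,s_q)$, where for each $i$ the cone $\mathcal K_i$ and the face $\mathcal C_{s_i}$ of $\mathcal K_i$ with defining vector $s_i\in\mathcal K_i^*$ are as in one of the cases above, then $\mathcal C_s=\mathcal C_{s_1}\times\dots\times\mathcal C_{s_q}$ admits quadratic facial violation relative to $s$.
   Context: $\mathcal K^*=\{s:\langle s,x\rangle\ge0\ \forall x\in\mathcal K\}$ is the dual cone. A cone is proper if it is convex, closed, pointed and has nonempty interior. Quadratic facial violation (QFV): for a closed convex cone $\mathcal K$ and $s\in\mathcal K^*$, $\mathcal C_s$ admits QFV relative to $s$ if for every compact set $B$ there is $\kappa>0$ such that $\operatorname{dist}^2(x,\mathcal C_s)\le\kappa\langle s,x\rangle$ for all $x\in B\cap\mathcal K$. Inner products: dot product on $\mathbb R^d$; trace product on the space $\mathbb S^d$ of symmetric $d\times d$ matrices. Cones: $\mathcal K^d_{\rm SOC}=\{(t,x)\in\mathbb R^d:\|x\|_2\le t\}$; $\mathbb S^d_+$ the positive semidefinite matrices; $\mathcal K^3_{\rm Exp}=\operatorname{cl}\{(u,v,w):v\exp(u/v)\le w,\ v>0\}$, with dual $\operatorname{cl}\{(u,v,w):-u\exp(v/u)\le e\,w,\ u<0\}$;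 for $p\in(0,1)$, $\mathcal K^3_{\rm Pow}=\{(u,v,w):u^pv^{1-p}\ge|w|,\ u,v\ge0\}$, with dual $\{(u,v,w):(u/p)^p(v/(1-p))^{1-p}\ge|w|,\ u,v\ge0\}$. *)

theory Defs
  imports "HOL-Analysis.Analysis"
begin

text \<open>
  The general notions take the ambient Euclidean space as a linear subspace \<open>E\<close> of a Euclidean type,
  so that symmetric matrices and spaces of varying dimension can be treated. When \<open>E\<close> is all of the
  type they are the usual ones.
\<close>

definition dual_cone :: "'a::euclidean_space set \<Rightarrow> 'a set \<Rightarrow> 'a set" where
  "dual_cone E K = {s \<in> E. \<forall>x\<in>K. 0 \<le> s \<bullet> x}"

definition exposed_face :: "'a::euclidean_space set \<Rightarrow> 'a \<Rightarrow> 'a set" where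
  "exposed_face K s = {x \<in> K. s \<bullet> x = 0}"

definition proper_cone :: "'a::euclidean_space set \<Rightarrow> 'a set \<Rightarrow> bool" where
  "proper_cone E K \<longleftrightarrow> K \<subseteq> E \<and> convex_cone K \<and> closed K \<and> K \<inter> uminus ` K = {0} \<and>
     (top_of_set E) interior_of K \<noteq> {}"

text \<open>The face \<open>exposed_face K s\<close> admits quadratic facial violation relative to \<open>s\<close>.\<close>

definition qfv :: "'a::euclidean_space set \<Rightarrow> 'a \<Rightarrow> bool" where
  "qfv K s \<longleftrightarrow> (\<forall>B. compact B \<longrightarrow>
     (\<exists>\<kappa>>0. \<forall>x \<in> B \<inter> K. (infdist x (exposed_face K s))\<^sup>2 \<le> \<kappa> * (s \<bullet> x)))"

definition cone_setting :: "'a::euclidean_space set \<Rightarrow> 'a set \<Rightarrow> 'a \<Rightarrow> bool" where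
  "cone_setting E K s \<longleftrightarrow> K \<subseteq> E \<and> closed K \<and> convex_cone K \<and> s \<in> dual_cone E K"

text \<open>
  The space of real vectors indexed by \<open>I\<close>, realised as a coordinate subspace of \<open>real^'n\<close>, is
  \<open>R^d\<close> with \<open>d = card I\<close>; for \<open>I = UNIV\<close> it is the whole type. Since \<open>I\<close> is a value and not a type,
  the factors of one Cartesian product can have different dimensions.
\<close>

definition vec_space :: "'n::finite set \<Rightarrow> (real^'n) set" where
  "vec_space I = {x. \<forall>i. i \<notin> I \<longrightarrow> x $ i = 0}"

definition nonneg_orthant :: "'n::finite set \<Rightarrow> (real^'n) set" where
  "nonneg_orthant I = {x \<in> vec_space I. \<forall>i\<in>I. 0 \<le> x $ i}"

text \<open>In the second-order cone, \<open>k\<close> is the index of the scalar component \<open>t\<close> of \<open>(t, x)\<close>.\<close>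

definition soc :: "'n::finite set \<Rightarrow> 'n \<Rightarrow> (real^'n) set" where
  "soc I k = {y \<in> vec_space I. norm (\<chi> i. if i = k then 0 else y $ i) \<le> y $ k}"

text \<open>
  Symmetric matrices with rows and columns indexed by \<open>I\<close>. The library inner product on
  \<open>real^'n^'n\<close> is the trace product, see \<open>inner_eq_trace\<close> below.
\<close>

definition sym_space :: "'n::finite set \<Rightarrow> (real^'n^'n) set" where
  "sym_space I = {A. transpose A = A \<and> (\<forall>i j. i \<notin> I \<or> j \<notin> I \<longrightarrow> A $ i $ j = 0)}"

definition psd_cone :: "'n::finite set \<Rightarrow> (real^'n^'n) set" where
  "psd_cone I = {A \<in> sym_space I. \<forall>v \<in> vec_space I. 0 \<le> v \<bullet> (A *v v)}"

lemma vec_space_UNIV: "vec_space UNIV = UNIV"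
  by (simp add: vec_space_def)

lemma inner_eq_trace: "A \<bullet> B = trace (A ** B)"
  if "A \<in> sym_space I" for A B :: "real^'n^'n"
proof -
  have "A $ i $ j = A $ j $ i" for i j
    using that by (metis (mono_tags, lifting) mem_Collect_eq sym_space_def transpose_def vec_lambda_beta)
  then have "trace (A ** B) = (\<Sum>i\<in>UNIV. \<Sum>j\<in>UNIV. A $ j $ i * B $ j $ i)"
    by (simp add: trace_def matrix_matrix_mult_def)
  also have "\<dots> = A \<bullet> B"
    by (subst sum.swap) (simp add: inner_vec_def)
  finally show ?thesis by simp
qed

definition exp_cone :: "(real^3) set" where
  "exp_cone = closure {vector [u, v, w] | u v w. v * exp (u / v) \<le> w \<and> v > 0}"

definition pow_cone :: "real \<Rightarrow> (real^3) set" where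
  "pow_cone p = {vector [u, v, w] | u v w.
     u powr p * v powr (1 - p) \<ge> \<bar>w\<bar> \<and> u \<ge> 0 \<and> v \<ge> 0}"

definition strictly_complementary :: "'a::euclidean_space set \<Rightarrow> 'a set \<Rightarrow> 'a \<Rightarrow> bool" where
  "strictly_complementary E K s \<longleftrightarrow> (\<exists>x\<in>K. x \<bullet> s = 0 \<and>
     x \<in> rel_interior (exposed_face K s) \<and> s \<in> rel_interior (exposed_face (dual_cone E K) x))"

definition pow_param :: "real \<Rightarrow> real \<Rightarrow> real \<Rightarrow> bool" where
  "pow_param p a c \<longleftrightarrow> 0 < p \<and> p < 1 \<and> a > 0 \<and> c \<noteq> 0 \<and> (a / p) powr p = \<bar>c\<bar>"

text \<open>For \<open>pow_param p a c\<close> these are \<open>\<sigma>\<close> (with \<open>\<sigma>_x = a\<close>, \<open>\<sigma>_z = c\<close>) and its complementary direction.\<close>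

definition pow_sigma :: "real \<Rightarrow> real \<Rightarrow> real \<Rightarrow> real^3" where
  "pow_sigma p a c = vector [a, 1 - p, c]"

definition pow_ray :: "real \<Rightarrow> real \<Rightarrow> real \<Rightarrow> real^3" where
  "pow_ray p a c = vector [p / a, 1, - 1 / c]"

definition listed_vec :: "'n::finite set \<Rightarrow> (real^'n) set \<Rightarrow> real^'n \<Rightarrow> bool" where
  "listed_vec I K s \<longleftrightarrow> cone_setting (vec_space I) K s \<and>
     (K = {0} \<or> K = vec_space I
      \<or> proper_cone (vec_space I) K \<and> (exposed_face K s = {0} \<or> exposed_face K s = K)
      \<or> K = nonneg_orthant I
      \<or> (\<exists>k\<in>I. K = soc I k))"

definition listed_sym :: "'n::finite set \<Rightarrow> (real^'n^'n) set \<Rightarrow> real^'n^'n \<Rightarrow> bool" where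
  "listed_sym I K s \<longleftrightarrow> cone_setting (sym_space I) K s \<and> K = psd_cone I"

definition listed_3d :: "(real^3) set \<Rightarrow> real^3 \<Rightarrow> bool" where
  "listed_3d K s \<longleftrightarrow> cone_setting UNIV K s \<and>
     ((K = exp_cone \<or> K = dual_cone UNIV exp_cone) \<and> strictly_complementary UNIV K s
      \<or> (\<exists>p a c. pow_param p a c \<and> K = pow_cone p \<and> s = pow_sigma p a c)
      \<or> (\<exists>p a c t. pow_param p a c \<and> t > 0 \<and>
           K = dual_cone UNIV (pow_cone p) \<and> s = t *\<^sub>R pow_ray p a c))"

text \<open>
  The factors of a Cartesian product are regarded as subsets of one Euclidean type: a factor \<open>K\<close> with
  ambient space \<open>E\<close> and vector \<open>s\<close> is placed there by a linear map that preserves the inner product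
  on \<open>E\<close>. Any finite family of Euclidean spaces fits into a common one in this way.
\<close>

definition isometric_copy ::
  "'b::euclidean_space set \<Rightarrow> 'b set \<Rightarrow> 'b \<Rightarrow> 'a::euclidean_space set \<Rightarrow> 'a \<Rightarrow> bool" where
  "isometric_copy E K s K' s' \<longleftrightarrow>
     (\<exists>f. linear f \<and> (\<forall>x\<in>E. \<forall>y\<in>E. f x \<bullet> f y = x \<bullet> y) \<and> K' = f ` K \<and> s' = f s)"

definition cart_prod :: "('q::finite \<Rightarrow> 'a set) \<Rightarrow> ('a^'q) set" where
  "cart_prod K = {x. \<forall>i. x $ i \<in> K i}"

end

theory Submission
  imports Defs
begin

text \<open>
  For cones the facial violation is homogeneous, so it suffices to find for each \<open>x\<close> in the cone a point
  \<open>y\<close> of the face with \<open>\<parallel>x - y\<parallel>\<^sup>2 \<le> \<kappa> \<parallel>x\<parallel> \<langle>s, x\<rangle>\<close>. In this form the property passes to products and to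
  injective linear images, which reduces the three-dimensional cones to a few normal forms. If the face
  is trivial, \<open>\<langle>s, x\<rangle>\<close> is bounded below by a multiple of \<open>\<parallel>x\<parallel>\<close> on the cone. For a positive semidefinite
  \<open>S = \<Sum> w w\<^sup>T\<close> one takes \<open>y = P x P\<close>, where \<open>P\<close> projects onto the kernel of \<open>S\<close>. For the exponential
  cone the bound comes from \<open>r\<^sup>2 \<le> (2 + \<bar>r\<bar>) (e\<^sup>r - 1 - r)\<close>; strict complementarity only excludes
  the multiples of \<open>(0, 0, 1)\<close>. For the power cone it comes from
  \<open>p u + (1 - p) v - u\<^sup>p v\<^sup>1\<^sup>-\<^sup>p \<ge> min p (1 - p) (\<surd>u - \<surd>v)\<^sup>2\<close>.
\<close>

section \<open>Homogeneous error bounds\<close>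

text \<open>Both sides of the bound have degree 2 in \<open>x\<close>, so a single constant serves
  the whole cone, and a compact set enters only through a bound on its norms. A witness
  \<open>y\<close> stands in for the distance because witnesses combine coordinatewise in a product
  and are carried along by linear maps, which distort norms only by bounded factors. The obstacle is
  the direction (0, 0, 1) of the exponential cone. Its face consists of the points (u, 0, 0) with u
  \<le> 0. The points (-1, v, v exp (-1/v)) have distance at least v from it, while their violation
  v exp (-1/v) is smaller than every power of v as v tends to 0, so no quadratic bound can hold
  there.\<close>

definition face_error_bound :: "'a::euclidean_space set \<Rightarrow> 'a \<Rightarrow> bool" where
  "face_error_bound K s \<longleftrightarrow> (\<exists>\<kappa>\<ge>0. \<forall>x\<in>K. \<exists>y\<in>exposed_face K s.
     (norm (x - y))\<^sup>2 \<le> \<kappa> * norm x * (s \<bullet> x))"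

lemma face_error_boundI:
  assumes "0 \<le> \<kappa>"
    and "\<And>x. x \<in> K \<Longrightarrow> \<exists>y\<in>exposed_face K s. (norm (x - y))\<^sup>2 \<le> \<kappa> * norm x * (s \<bullet> x)"
  shows "face_error_bound K s"
  using assms unfolding face_error_bound_def by blast

lemma qfv_if_face_error_bound:
  assumes "face_error_bound K s" and pos: "\<And>x. x \<in> K \<Longrightarrow> 0 \<le> s \<bullet> x"
  shows "qfv K s"
  unfolding qfv_def
proof (intro allI impI)
  fix B :: "'a set"
  assume "compact B"
  then obtain R where R: "R > 0" "\<And>x. x \<in> B \<Longrightarrow> norm x \<le> R"
    using bounded_pos compact_imp_bounded by metis
  obtain k where k: "k \<ge> 0" and
    *: "\<And>x. x \<in> K \<Longrightarrow> \<exists>y\<in>exposed_face K s. (norm (x - y))\<^sup>2 \<le> k * norm x * (s \<bullet> x)"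
    using assms(1) unfolding face_error_bound_def by blast
  \<comment> \<open>The notion asks for a strictly positive constant; the summand 1 provides it when
    \<open>k = 0\<close>.\<close>
  have "(infdist x (exposed_face K s))\<^sup>2 \<le> (k * R + 1) * (s \<bullet> x)" if x: "x \<in> B \<inter> K" for x
  proof -
    obtain y where y: "y \<in> exposed_face K s" "(norm (x - y))\<^sup>2 \<le> k * norm x * (s \<bullet> x)"
      using * x by blast
    have "infdist x (exposed_face K s) \<le> norm (x - y)"
      using infdist_le[OF y(1), of x] by (simp add: dist_norm)
    then have "(infdist x (exposed_face K s))\<^sup>2 \<le> (norm (x - y))\<^sup>2"
      by (simp add: infdist_nonneg power_mono)
    also have "\<dots> \<le> (k * norm x) * (s \<bullet> x)" using y by simp
    also have "\<dots> \<le> (k * R + 1) * (s \<bullet> x)"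
    proof (rule mult_right_mono)
      have "k * norm x \<le> k * R" using R(2)[of x] x k by (intro mult_left_mono) auto
      then show "k * norm x \<le> k * R + 1" by simp
    qed (use pos x in auto)
    finally show ?thesis .
  qed
  moreover have "k * R + 1 > 0" using k R by (simp add: add_nonneg_pos)
  ultimately show "\<exists>\<kappa>>0. \<forall>x\<in>B \<inter> K. (infdist x (exposed_face K s))\<^sup>2 \<le> \<kappa> * (s \<bullet> x)"
    by blast
qed

lemma qfv_if_cone_setting:
  assumes "cone_setting E K s" "face_error_bound K s"
  shows "qfv K s"
  using assms by (intro qfv_if_face_error_bound) (auto simp: cone_setting_def dual_cone_def)

lemma exposed_face_image:
  assumes "t \<noteq> 0" and "\<And>x. x \<in> K \<Longrightarrow> s' \<bullet> f x = t * (s \<bullet> x)"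
  shows "exposed_face (f ` K) s' = f ` exposed_face K s"
  using assms unfolding exposed_face_def by auto

text \<open>The comparison of norms is demanded on \<open>K\<close> only: an isometric copy
  preserves norms merely on \<open>E\<close> and may collapse other directions, whereas an injective
  map satisfies it everywhere.\<close>

lemma face_error_bound_linear_image:
  assumes "face_error_bound K s" and f: "linear f" and M: "\<And>x. x \<in> K \<Longrightarrow> norm x \<le> M * norm (f x)"
    and t: "t > 0" and s: "\<And>x. x \<in> K \<Longrightarrow> s' \<bullet> f x = t * (s \<bullet> x)"
    and pos: "\<And>x. x \<in> K \<Longrightarrow> 0 \<le> s \<bullet> x"
  shows "face_error_bound (f ` K) s'"
proof -
  obtain k where k: "k \<ge> 0" and
    *: "\<And>x. x \<in> K \<Longrightarrow> \<exists>y\<in>exposed_face K s. (norm (x - y))\<^sup>2 \<le> k * norm x * (s \<bullet> x)"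
    using assms(1) unfolding face_error_bound_def by blast
  obtain L where L: "L > 0" "\<And>x. norm (f x) \<le> L * norm x"
    using linear_bounded_pos[OF f] by blast
  have face: "exposed_face (f ` K) s' = f ` exposed_face K s"
    using exposed_face_image[of t K s' f s] t s by simp
  \<comment> \<open>The square of \<open>L\<close> bounds the image of \<open>x - y\<close>,
    \<open>\<bar>M\<bar>\<close> replaces \<open>norm x\<close> by \<open>norm (f x)\<close>, and
    \<open>1 / t\<close> converts the violation. The absolute value keeps the constant nonnegative,
    as \<open>M\<close> may be negative when \<open>K\<close> has no nonzero element.\<close>
  let ?k = "L\<^sup>2 * k * \<bar>M\<bar> / t"
  show ?thesis
  proof (rule face_error_boundI)
    show "0 \<le> ?k" using k t by simp
    fix z assume "z \<in> f ` K"
    then obtain x where x: "x \<in> K" "z = f x" by blast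
    obtain y where y: "y \<in> exposed_face K s" "(norm (x - y))\<^sup>2 \<le> k * norm x * (s \<bullet> x)"
      using * x by blast
    have "norm (f x - f y) \<le> L * norm (x - y)"
      using L(2)[of "x - y"] f by (simp add: linear_diff)
    then have "(norm (f x - f y))\<^sup>2 \<le> (L * norm (x - y))\<^sup>2"
      by (simp add: power_mono)
    also have "\<dots> \<le> L\<^sup>2 * (k * norm x * (s \<bullet> x))"
      using y(2) by (simp add: power_mult_distrib mult_left_mono)
    also have "\<dots> \<le> L\<^sup>2 * (k * (\<bar>M\<bar> * norm (f x)) * (s \<bullet> x))"
    proof -
      have "norm x \<le> \<bar>M\<bar> * norm (f x)"
        using M[OF x(1)] by (meson abs_ge_self mult_right_mono norm_ge_zero order_trans)
      then show ?thesis using k pos[OF x(1)]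
        by (intro mult_left_mono mult_right_mono) auto
    qed
    also have "\<dots> = ?k * norm (f x) * (s' \<bullet> f x)"
      using t s[OF x(1)] by simp
    finally show "\<exists>y\<in>exposed_face (f ` K) s'. (norm (z - y))\<^sup>2 \<le> ?k * norm z * (s' \<bullet> z)"
      using face y(1) x(2) by blast
  qed
qed

lemma face_error_bound_isometric_copy:
  assumes "isometric_copy E K s K' s'" "face_error_bound K s" "K \<subseteq> E" "s \<in> dual_cone E K"
  shows "face_error_bound K' s'" "\<And>x. x \<in> K' \<Longrightarrow> 0 \<le> s' \<bullet> x"
proof -
  obtain f where f: "linear f" "\<And>x y. x \<in> E \<Longrightarrow> y \<in> E \<Longrightarrow> f x \<bullet> f y = x \<bullet> y"
    and K': "K' = f ` K" "s' = f s"
    using assms(1) unfolding isometric_copy_def by blast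
  have s: "s \<in> E" "\<And>x. x \<in> K \<Longrightarrow> 0 \<le> s \<bullet> x"
    using assms(4) unfolding dual_cone_def by auto
  have ip: "f s \<bullet> f x = s \<bullet> x" "norm (f x) = norm x" if "x \<in> K" for x
    using f(2) s that assms(3) by (auto simp: norm_eq_sqrt_inner)
  show "face_error_bound K' s'"
    unfolding K' using f(1) ip s
    by (intro face_error_bound_linear_image[OF assms(2), where M = 1 and t = 1]) auto
  show "0 \<le> s' \<bullet> x" if "x \<in> K'" for x
    using that ip s unfolding K' by auto
qed

text \<open>All summands of \<open>s \<bullet> x\<close> are nonnegative, so it vanishes only if
  each of them does; squared distances add up over the factors just as violations do.\<close>

lemma
  fixes K :: "'q::finite \<Rightarrow> 'a::euclidean_space set" and s :: "'a^'q"
  assumes pos: "\<And>i x. x \<in> K i \<Longrightarrow> 0 \<le> s $ i \<bullet> x"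
  shows exposed_face_cart_prod:
      "exposed_face (cart_prod K) s = cart_prod (\<lambda>i. exposed_face (K i) (s $ i))"
    and face_error_bound_cart_prod:
      "(\<And>i. face_error_bound (K i) (s $ i)) \<Longrightarrow> face_error_bound (cart_prod K) s"
proof -
  show face: "exposed_face (cart_prod K) s = cart_prod (\<lambda>i. exposed_face (K i) (s $ i))"
    unfolding exposed_face_def cart_prod_def using pos
    by (auto simp: inner_vec_def sum_nonneg_eq_0_iff)
  assume "\<And>i. face_error_bound (K i) (s $ i)"
  then have "\<forall>i. \<exists>k\<ge>0. \<forall>x\<in>K i. \<exists>y\<in>exposed_face (K i) (s $ i).
     (norm (x - y))\<^sup>2 \<le> k * norm x * (s $ i \<bullet> x)"
    unfolding face_error_bound_def by blast
  then obtain k where k: "\<And>i. k i \<ge> 0"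
    "\<And>i x. x \<in> K i \<Longrightarrow> \<exists>y\<in>exposed_face (K i) (s $ i). (norm (x - y))\<^sup>2 \<le> k i * norm x * (s $ i \<bullet> x)"
    by metis
  let ?k = "\<Sum>i\<in>UNIV. k i"
  show "face_error_bound (cart_prod K) s"
  proof (rule face_error_boundI)
    show "0 \<le> ?k" using k(1) by (simp add: sum_nonneg)
    fix x assume "x \<in> cart_prod K"
    then have x: "x $ i \<in> K i" for i by (simp add: cart_prod_def)
    then have "\<forall>i. \<exists>y. y \<in> exposed_face (K i) (s $ i) \<and>
        (norm (x $ i - y))\<^sup>2 \<le> k i * norm (x $ i) * (s $ i \<bullet> x $ i)"
      using k(2) by blast
    then obtain y where y: "\<And>i. y i \<in> exposed_face (K i) (s $ i)"
      "\<And>i. (norm (x $ i - y i))\<^sup>2 \<le> k i * norm (x $ i) * (s $ i \<bullet> x $ i)"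
      by metis
    have "(norm (x - (\<chi> i. y i)))\<^sup>2 = (\<Sum>i\<in>UNIV. (norm (x $ i - y i))\<^sup>2)"
      by (simp add: power2_norm_eq_inner inner_vec_def)
    also have "\<dots> \<le> (\<Sum>i\<in>UNIV. ?k * norm x * (s $ i \<bullet> x $ i))"
    proof (rule sum_mono)
      fix i
      have "k i \<le> ?k" using k(1) by (simp add: member_le_sum)
      then have "k i * norm (x $ i) \<le> ?k * norm x"
        using k(1) by (intro mult_mono) (auto simp: Finite_Cartesian_Product.norm_nth_le sum_nonneg)
      then show "(norm (x $ i - y i))\<^sup>2 \<le> ?k * norm x * (s $ i \<bullet> x $ i)"
        using y(2)[of i] pos[OF x, of i] by (meson mult_right_mono order_trans)
    qed
    also have "\<dots> = ?k * norm x * (s \<bullet> x)"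
      by (simp add: inner_vec_def sum_distrib_left)
    finally show "\<exists>y\<in>exposed_face (cart_prod K) s. (norm (x - y))\<^sup>2 \<le> ?k * norm x * (s \<bullet> x)"
      unfolding face using y(1) by (intro bexI[of _ "\<chi> i. y i"]) (auto simp: cart_prod_def)
  qed
qed

section \<open>Trivial faces, orthants and second-order cones\<close>

lemma face_error_bound_full_face:
  assumes "exposed_face K s = K"
  shows "face_error_bound K s"
  using assms unfolding face_error_bound_def exposed_face_def
  by (intro exI[of _ 0]) auto

lemma face_error_bound_trivial_face:
  assumes "closed K" "conic K" "\<And>x. x \<in> K \<Longrightarrow> 0 \<le> s \<bullet> x" "exposed_face K s = {0}"
  shows "face_error_bound K s"
\<comment> \<open>A minimum exists only on a nonempty set; if the cone misses the unit sphere it is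
  {0}.\<close>
proof (cases "K \<inter> sphere 0 1 = {}")
  case True
  have "x = 0" if "x \<in> K" for x
  proof (rule ccontr)
    assume "x \<noteq> 0"
    then have "(1 / norm x) *\<^sub>R x \<in> K \<inter> sphere 0 1"
      using conicD[OF assms(2) that, of "1 / norm x"] by simp
    then show False using True by blast
  qed
  then show ?thesis
    using assms(4) by (intro face_error_boundI[of 0]) auto
next
  case False
  have comp: "compact (K \<inter> sphere 0 1)" using assms(1) by (simp add: closed_Int_compact)
  have cont: "continuous_on (K \<inter> sphere 0 1) (\<lambda>x. s \<bullet> x)" by (intro continuous_intros)
  \<comment> \<open>The minimum over the unit vectors of \<open>K\<close> is positive because its
    minimiser lies outside the face; homogeneity turns it into the linear lower bound below.\<close>
  obtain m where m: "m \<in> K \<inter> sphere 0 1" "\<And>x. x \<in> K \<inter> sphere 0 1 \<Longrightarrow> s \<bullet> m \<le> s \<bullet> x"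
    using continuous_attains_inf[OF comp False cont] by blast
  have "m \<noteq> 0" "m \<in> K" using m(1) by auto
  then have c: "s \<bullet> m > 0" using assms(3)[of m] assms(4) unfolding exposed_face_def
    by (smt (verit) mem_Collect_eq singletonD)
  have bound: "(s \<bullet> m) * norm x \<le> s \<bullet> x" if x: "x \<in> K" for x
  proof (cases "x = 0")
    case False
    then have "(1 / norm x) *\<^sub>R x \<in> K \<inter> sphere 0 1"
      using conicD[OF assms(2) that, of "1 / norm x"] by simp
    from m(2)[OF this] show ?thesis using False by (simp add: field_simps)
  qed simp
  show ?thesis
  proof (rule face_error_boundI[of "1 / (s \<bullet> m)"])
    fix x assume x: "x \<in> K"
    have "(norm (x - 0))\<^sup>2 = 1 / (s \<bullet> m) * norm x * ((s \<bullet> m) * norm x)"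
      using c by (simp add: power2_eq_square)
    also have "\<dots> \<le> 1 / (s \<bullet> m) * norm x * (s \<bullet> x)"
      using bound[OF x] c by (intro mult_left_mono) auto
    finally show "\<exists>y\<in>exposed_face K s. (norm (x - y))\<^sup>2 \<le> 1 / (s \<bullet> m) * norm x * (s \<bullet> x)"
      using assms(4) by blast
  qed (use c in auto)
qed

text \<open>Testing \<open>s\<close> against \<open>- s\<close> leaves no nonzero dual vector, so
  the face of the whole space is the whole space.\<close>

lemma dual_cone_vec_space:
  assumes "s \<in> dual_cone (vec_space I) (vec_space I)"
  shows "s = 0"
proof -
  have "- s \<in> vec_space I" using assms by (auto simp: dual_cone_def vec_space_def)
  then have "0 \<le> s \<bullet> (- s)" using assms unfolding dual_cone_def by blast
  then show ?thesis by (metis inner_minus_right inner_ge_zero inner_eq_zero_iff neg_0_le_iff_le order_antisym)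
qed

lemma face_error_bound_nonneg_orthant:
  fixes s :: "real^'n"
  assumes s: "s \<in> dual_cone (vec_space I) (nonneg_orthant I)"
  shows "face_error_bound (nonneg_orthant I) s"
proof -
  have s_out: "s $ i = 0" if "i \<notin> I" for i
    using s that by (auto simp: dual_cone_def vec_space_def)
  have s_pos: "0 \<le> s $ i" for i
  proof (cases "i \<in> I")
    case True
    then have "axis i 1 \<in> nonneg_orthant I"
      by (auto simp: nonneg_orthant_def vec_space_def axis_def)
    then have "0 \<le> s \<bullet> axis i 1" using s by (auto simp: dual_cone_def)
    then show ?thesis by (simp add: inner_axis)
  qed (simp add: s_out)
  \<comment> \<open>Division by zero gives 0, so only coordinates with \<open>s $ i > 0\<close>
    count, and for these \<open>1 / s $ i \<le> k\<close> becomes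
    \<open>1 \<le> k * s $ i\<close>.\<close>
  define k where "k = (\<Sum>i\<in>UNIV. 1 / s $ i)"
  show ?thesis
  proof (rule face_error_boundI[of k])
    show "0 \<le> k" unfolding k_def using s_pos by (simp add: sum_nonneg)
    fix x assume x: "x \<in> nonneg_orthant I"
    have x_pos: "0 \<le> x $ i" for i
      using x by (cases "i \<in> I") (auto simp: nonneg_orthant_def vec_space_def)
    define y where "y = (\<chi> i. if s $ i = 0 then x $ i else 0)"
    have "s \<bullet> y = 0" unfolding y_def inner_vec_def by (auto intro: sum.neutral)
    then have y: "y \<in> exposed_face (nonneg_orthant I) s"
      using x unfolding y_def exposed_face_def nonneg_orthant_def vec_space_def by auto
    have "(norm (x - y))\<^sup>2 = (\<Sum>i\<in>UNIV. (x $ i - y $ i)\<^sup>2)"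
      unfolding power2_norm_eq_inner by (simp add: inner_vec_def power2_eq_square)
    also have "\<dots> \<le> (\<Sum>i\<in>UNIV. k * norm x * (s $ i * x $ i))"
    proof (rule sum_mono)
      fix i
      show "(x $ i - y $ i)\<^sup>2 \<le> k * norm x * (s $ i * x $ i)"
      proof (cases "s $ i = 0")
        case False
        then have si: "s $ i > 0" using s_pos[of i] by simp
        have "1 / s $ i \<le> k" unfolding k_def
          by (rule member_le_sum[where f = "\<lambda>i. 1 / s $ i"]) (use s_pos in auto)
        then have 1: "1 \<le> k * s $ i" using si by (simp add: field_simps)
        have "x $ i \<le> norm x" using component_le_norm_cart[of x i] by simp
        then have "(x $ i)\<^sup>2 \<le> norm x * x $ i" using x_pos[of i]
          by (simp add: power2_eq_square mult_right_mono)
        also have "\<dots> \<le> (k * s $ i) * (norm x * x $ i)"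
          using mult_right_mono[OF 1, of "norm x * x $ i"] x_pos[of i] by simp
        finally show ?thesis using False by (simp add: y_def algebra_simps)
      qed (simp add: y_def)
    qed
    also have "\<dots> = k * norm x * (s \<bullet> x)" by (simp add: inner_vec_def sum_distrib_left)
    finally show "\<exists>y\<in>exposed_face (nonneg_orthant I) s. (norm (x - y))\<^sup>2 \<le> k * norm x * (s \<bullet> x)"
      using y by blast
  qed
qed

text \<open>The cone is self-dual, and the position of \<open>s\<close> decides: in the interior the
  face is {0}, at the apex it is the whole cone, elsewhere on the boundary it is a ray.\<close>

lemma face_error_bound_soc:
  fixes s :: "real^'n"
  assumes kI: "k \<in> I" and s: "s \<in> dual_cone (vec_space I) (soc I k)"
    and soc: "closed (soc I k)" "conic (soc I k)"
  shows "face_error_bound (soc I k) s"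
proof -
  define T :: "real^'n \<Rightarrow> real^'n" where "T v = (\<chi> i. if i = k then 0 else v $ i)" for v
  have decomp: "v = v $ k *\<^sub>R axis k 1 + T v" for v
    by (auto simp: vec_eq_iff T_def axis_def)
  have Tk: "T v $ k = 0" for v by (simp add: T_def)
  have inner: "v \<bullet> w = v $ k * w $ k + T v \<bullet> T w" for v w
    by (subst decomp[of v], subst decomp[of w])
      (simp add: inner_add_left inner_add_right inner_axis inner_axis' Tk)
  have socI: "w *\<^sub>R axis k 1 + v \<in> soc I k" if "v \<in> vec_space I" "v $ k = 0" "norm v \<le> w" for v w
  proof -
    have "T (w *\<^sub>R axis k 1 + v) = v" using that by (auto simp: T_def vec_eq_iff axis_def)
    then show ?thesis using that kI unfolding soc_def T_def[symmetric]
      by (auto simp: vec_space_def axis_def)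
  qed
  have socD: "v \<in> vec_space I" "norm (T v) \<le> v $ k" if "v \<in> soc I k" for v
    using that by (auto simp: soc_def T_def)
  have T_vec: "T v \<in> vec_space I" if "v \<in> vec_space I" for v
    using that by (auto simp: vec_space_def T_def)
  have s_vec: "s \<in> vec_space I" and s_pos: "\<And>x. x \<in> soc I k \<Longrightarrow> 0 \<le> s \<bullet> x"
    using s by (auto simp: dual_cone_def)
  have s_soc: "norm (T s) \<le> s $ k"
  proof -
    \<comment> \<open>The worst test vector: on the boundary, with vector part opposite to that of
      \<open>s\<close>. It settles \<open>T s \<noteq> 0\<close>; the axis used below settles
      \<open>T s = 0\<close>.\<close>
    let ?x = "norm (T s) *\<^sub>R axis k 1 + - T s"
    have 0: "T ?x = - T s"
      by (auto simp: T_def vec_eq_iff axis_def)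
    have "?x \<in> soc I k"
      using T_vec[OF s_vec] by (intro socI) (auto simp: vec_space_def Tk)
    from s_pos[OF this] have "0 \<le> s $ k * norm (T s) - (norm (T s))\<^sup>2"
      unfolding inner[of s ?x] 0 by (simp add: Tk power2_norm_eq_inner)
    then have 1: "norm (T s) * norm (T s) \<le> s $ k * norm (T s)" by (simp add: power2_eq_square)
    have "1 *\<^sub>R axis k 1 + 0 \<in> soc I k"
      by (intro socI) (auto simp: vec_space_def)
    from s_pos[OF this] have "0 \<le> s $ k" by (simp add: inner_axis)
    then show ?thesis using 1 by (cases "T s = 0") auto
  qed
  consider "norm (T s) < s $ k" | "s $ k = 0" | "norm (T s) = s $ k" "s $ k > 0"
    using s_soc norm_ge_zero[of "T s"] by linarith
  then show ?thesis
  proof cases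
    case 1
    have "x = 0" if x: "x \<in> soc I k" "s \<bullet> x = 0" for x
    proof -
      have "- (T s \<bullet> T x) \<le> norm (T s) * norm (T x)"
        using Cauchy_Schwarz_ineq2[of "T s" "T x"] by linarith
      also have "\<dots> \<le> norm (T s) * x $ k" using socD(2)[OF x(1)] by (simp add: mult_left_mono)
      finally have "(s $ k - norm (T s)) * x $ k \<le> 0"
        using x(2) inner[of s x] by (simp add: algebra_simps)
      then have "x $ k \<le> 0" using 1 by (simp add: mult_le_0_iff)
      then have "x $ k = 0" "norm (T x) \<le> 0" using socD(2)[OF x(1)] norm_ge_zero[of "T x"]
        by linarith+
      then show ?thesis using decomp[of x] by simp
    qed
    moreover have "0 \<in> soc I k" using socI[of 0 0] by (simp add: vec_space_def)
    ultimately have "exposed_face (soc I k) s = {0}" by (auto simp: exposed_face_def)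
    then show ?thesis using soc s_pos by (intro face_error_bound_trivial_face)
  next
    case 2
    then have "s = 0" using s_soc decomp[of s] by simp
    then show ?thesis by (intro face_error_bound_full_face) (simp add: exposed_face_def)
  next
    case 3
    \<comment> \<open>The unit vector opposite to \<open>T s\<close>; the face is the ray spanned by
      \<open>axis k 1 + e\<close>.\<close>
    define e where "e = (- 1 / s $ k) *\<^sub>R T s"
    have e: "norm e = 1" "e $ k = 0" "T e = e" "T s \<bullet> e = - s $ k" "T s = - s $ k *\<^sub>R e"
    proof -
      show "norm e = 1" "e $ k = 0" "T s = - s $ k *\<^sub>R e"
        using 3 by (auto simp: e_def Tk)
      show "T e = e" by (auto simp: e_def T_def vec_eq_iff)
      have "T s \<bullet> T s = s $ k * s $ k"
        using 3 power2_norm_eq_inner[of "T s"] by (simp add: power2_eq_square)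
      then show "T s \<bullet> e = - s $ k" using 3 by (simp add: e_def)
    qed
    have e_vec: "e \<in> vec_space I" using T_vec[OF s_vec] by (auto simp: e_def vec_space_def)
    show ?thesis
    proof (rule face_error_boundI[of "2 / s $ k"])
      fix x assume x: "x \<in> soc I k"
      \<comment> \<open>The point of the ray with the same scalar component as \<open>x\<close>, so
        that only the vector parts differ.\<close>
      define y where "y = x $ k *\<^sub>R axis k 1 + x $ k *\<^sub>R e"
      have xk: "0 \<le> x $ k" using socD(2)[OF x] norm_ge_zero[of "T x"] by linarith
      have Ty: "T y = x $ k *\<^sub>R e" "y $ k = x $ k"
        using e(2) by (auto simp: y_def T_def vec_eq_iff axis_def)
      have "y \<in> soc I k" unfolding y_def using e_vec e xk by (intro socI) (auto simp: vec_space_def)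
      moreover have "s \<bullet> y = 0" using inner[of s y] Ty e(4) by simp
      ultimately have y: "y \<in> exposed_face (soc I k) s" by (simp add: exposed_face_def)
      have sx: "s \<bullet> x = s $ k * (x $ k - T x \<bullet> e)"
        using inner[of s x] by (subst (asm) e(5)) (simp add: algebra_simps inner_commute)
      have "x - y = T x - x $ k *\<^sub>R e"
        using decomp[of x] decomp[of y] Ty by (simp add: algebra_simps)
      then have "(norm (x - y))\<^sup>2 = (T x - x $ k *\<^sub>R e) \<bullet> (T x - x $ k *\<^sub>R e)"
        by (simp add: power2_norm_eq_inner)
      also have "\<dots> = (norm (T x))\<^sup>2 - 2 * x $ k * (T x \<bullet> e) + (x $ k)\<^sup>2"
        using e(1) unfolding power2_norm_eq_inner
        by (simp add: norm_eq_1 inner_diff_left inner_diff_right inner_commute power2_eq_square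
            algebra_simps)
      \<comment> \<open>Membership in the cone replaces the squared norm of \<open>T x\<close> by
        that of \<open>x $ k\<close>, which leaves a multiple of the violation.\<close>
      also have "\<dots> \<le> 2 * x $ k * (x $ k - T x \<bullet> e)"
        using power_mono[OF socD(2)[OF x], of 2] by (simp add: power2_eq_square algebra_simps)
      also have "\<dots> = 2 / s $ k * x $ k * (s \<bullet> x)" using 3 sx by simp
      also have "\<dots> \<le> 2 / s $ k * norm x * (s \<bullet> x)"
        using component_le_norm_cart[of x k] 3 s_pos[OF x]
        by (intro mult_right_mono mult_left_mono) auto
      finally show "\<exists>y\<in>exposed_face (soc I k) s. (norm (x - y))\<^sup>2 \<le> 2 / s $ k * norm x * (s \<bullet> x)"
        using y by blast
    qed (use 3 in auto)
  qed
qed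

lemma face_error_bound_listed_vec:
  assumes "listed_vec I K s"
  shows "face_error_bound K s"
proof -
  have set: "closed K" "convex_cone K" "s \<in> dual_cone (vec_space I) K" "K \<subseteq> vec_space I"
    using assms by (auto simp: listed_vec_def cone_setting_def)
  then have conic: "conic K" and pos: "\<And>x. x \<in> K \<Longrightarrow> 0 \<le> s \<bullet> x"
    by (auto simp: convex_cone_def dual_cone_def)
  consider "K = {0}" | "K = vec_space I" | "exposed_face K s = {0}" | "exposed_face K s = K"
    | "K = nonneg_orthant I" | k where "k \<in> I" "K = soc I k"
    using assms unfolding listed_vec_def by blast
  then show ?thesis
  proof cases
    case 1
    then show ?thesis by (intro face_error_bound_full_face) (auto simp: exposed_face_def)
  next
    case 2
    then have "s = 0" using set dual_cone_vec_space by blast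
    then show ?thesis by (intro face_error_bound_full_face) (auto simp: exposed_face_def)
  next
    case 3
    then show ?thesis using set conic pos by (intro face_error_bound_trivial_face)
  next
    case 4
    then show ?thesis by (rule face_error_bound_full_face)
  next
    case 5
    then show ?thesis using set face_error_bound_nonneg_orthant by blast
  next
    case 6
    then show ?thesis using set conic face_error_bound_soc by blast
  qed
qed

section \<open>Positive semidefinite cones\<close>

text \<open>Positivity is tested on all vectors, not only on \<open>vec_space I\<close>, which keeps
  the index set out of the linear algebra.\<close>

definition psd :: "real^'n^'n \<Rightarrow> bool" where
  "psd X \<longleftrightarrow> transpose X = X \<and> (\<forall>v. 0 \<le> v \<bullet> (X *v v))"

definition outer :: "real^'n \<Rightarrow> real^'n^'n" where
  "outer w = (\<chi> i j. w $ i * w $ j)"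

lemma symmetric_matrix_inner:
  fixes X :: "real^'n^'n"
  assumes "transpose X = X"
  shows "u \<bullet> (X *v v) = (X *v u) \<bullet> v"
  using assms by (metis dot_lmul_matrix transpose_matrix_vector)

lemma psd_Cauchy_Schwarz:
  fixes X :: "real^'n^'n"
  assumes "psd X"
  shows "(u \<bullet> (X *v v))\<^sup>2 \<le> (u \<bullet> (X *v u)) * (v \<bullet> (X *v v))"
proof -
  have nn: "\<And>w. 0 \<le> w \<bullet> (X *v w)" using assms by (simp add: psd_def)
  have sym: "v \<bullet> (X *v u) = u \<bullet> (X *v v)"
    using assms by (metis psd_def symmetric_matrix_inner inner_commute)
  have quad: "0 \<le> a\<^sup>2 * (u \<bullet> (X *v u)) - 2 * a * b * (u \<bullet> (X *v v)) + b\<^sup>2 * (v \<bullet> (X *v v))" for a b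
    using nn[of "a *\<^sub>R u - b *\<^sub>R v"] sym
    by (simp add: matrix_vector_mult_diff_distrib matrix_vector_mult_scaleR inner_diff_left
        inner_diff_right power2_eq_square algebra_simps)
  let ?a = "v \<bullet> (X *v v)" and ?b = "u \<bullet> (X *v v)" and ?c = "u \<bullet> (X *v u)"
  show ?thesis
  proof (cases "?a = 0")
    case True
    have "0 \<le> ?c - 2 * t * ?b" for t using quad[of 1 t] True by simp
    have "?b = 0"
    proof (rule ccontr)
      assume "?b \<noteq> 0"
      \<comment> \<open>This choice of t would make the nonnegative quantity equal to -1.\<close>
      then have "2 * ((?c + 1) / (2 * ?b)) * ?b = ?c + 1" by simp
      then show False using \<open>0 \<le> ?c - 2 * ((?c + 1) / (2 * ?b)) * ?b\<close> by linarith
    qed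
    then show ?thesis using True by simp
  next
    case False
    then have a: "?a > 0" using nn[of v] by simp
    \<comment> \<open>The coefficients \<open>?a\<close> and \<open>?b\<close> are the minimising
      ones up to scale; they complete the square.\<close>
    have "0 \<le> ?a * (?a * ?c - ?b\<^sup>2)"
      using quad[of ?a ?b] by (simp add: power2_eq_square algebra_simps)
    then show ?thesis using a by (simp add: zero_le_mult_iff mult.commute)
  qed
qed

lemma norm_matrix_vector_mult_le:
  fixes X :: "real^'n^'m"
  shows "norm (X *v v) \<le> norm X * norm v"
proof -
  have "(norm (X *v v))\<^sup>2 = (\<Sum>i\<in>UNIV. (X $ i \<bullet> v)\<^sup>2)"
    unfolding power2_norm_eq_inner
    by (simp add: inner_vec_def[of "X *v v"] matrix_vector_mul_component power2_eq_square)
  also have "\<dots> \<le> (\<Sum>i\<in>UNIV. (norm (X $ i))\<^sup>2 * (norm v)\<^sup>2)"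
    using Cauchy_Schwarz_ineq by (intro sum_mono) (simp add: power2_norm_eq_inner)
  also have "\<dots> = (norm X * norm v)\<^sup>2"
    unfolding power_mult_distrib power2_norm_eq_inner[of X]
    by (simp add: inner_vec_def[of X] power2_norm_eq_inner sum_distrib_right)
  finally show ?thesis by (rule power2_le_imp_le) simp
qed

text \<open>This is where the exponent 2 comes from for matrices. Cauchy-Schwarz with
  \<open>u = X *v v\<close> puts the fourth power of \<open>norm u\<close> on the left, and the
  square of \<open>norm u\<close> cancels. A bound on the quadratic form at \<open>v\<close> thus
  controls \<open>X *v v\<close> up to a square root.\<close>

lemma psd_norm_matrix_vector_mult_sq:
  fixes X :: "real^'n^'n"
  assumes "psd X"
  shows "(norm (X *v v))\<^sup>2 \<le> norm X * (v \<bullet> (X *v v))"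
proof (cases "X *v v = 0")
  case False
  let ?u = "X *v v"
  have nn: "0 \<le> v \<bullet> (X *v v)" using assms by (simp add: psd_def)
  have "?u \<bullet> (X *v ?u) \<le> norm ?u * norm (X *v ?u)" by (rule norm_cauchy_schwarz)
  also have "\<dots> \<le> norm ?u * (norm X * norm ?u)"
    by (simp add: mult_left_mono norm_matrix_vector_mult_le)
  finally have 1: "?u \<bullet> (X *v ?u) \<le> norm X * (norm ?u)\<^sup>2"
    by (simp add: power2_eq_square algebra_simps)
  have "((norm ?u)\<^sup>2)\<^sup>2 \<le> (?u \<bullet> (X *v ?u)) * (v \<bullet> (X *v v))"
    using psd_Cauchy_Schwarz[OF assms, of ?u v] by (simp add: power2_norm_eq_inner)
  also have "\<dots> \<le> norm X * (norm ?u)\<^sup>2 * (v \<bullet> (X *v v))"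
    using 1 nn by (rule mult_right_mono)
  finally have "(norm ?u)\<^sup>2 * (norm ?u)\<^sup>2 \<le> (norm X * (v \<bullet> (X *v v))) * (norm ?u)\<^sup>2"
    by (simp add: power2_eq_square algebra_simps)
  then show ?thesis by (rule mult_right_le_imp_le) (use False in simp)
qed (use assms in \<open>simp add: psd_def\<close>)

lemma outer_inner: "outer w \<bullet> X = w \<bullet> (X *v w)"
  by (simp add: outer_def inner_vec_def matrix_vector_mult_def sum_distrib_left algebra_simps)

lemma outer_mult: "outer w *v u = (w \<bullet> u) *\<^sub>R w"
  by (simp add: outer_def vec_eq_iff inner_vec_def matrix_vector_mult_def sum_distrib_left
      algebra_simps)

lemma transpose_outer [simp]: "transpose (outer w) = outer w"
  by (simp add: outer_def transpose_def vec_eq_iff mult.commute)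

lemma psd_eq_0_if_quadratic_form_0:
  fixes S :: "real^'n^'n"
  assumes "psd S" "\<And>v. v \<bullet> (S *v v) = 0"
  shows "S = 0"
proof -
  have "S *v v = 0" for v
    using psd_norm_matrix_vector_mult_sq[OF assms(1), of v] assms(2)[of v] by simp
  then show ?thesis by (simp add: matrix_eq)
qed

text \<open>Subtracting \<open>(S v) (S v)\<^sup>T / (v\<^sup>T S v)\<close> keeps \<open>S\<close> positive semidefinite by the
  Cauchy--Schwarz inequality and lowers its rank, since \<open>v\<close> enters the kernel.\<close>

lemma psd_rank_one_decomposition:
  fixes S :: "real^'n^'n"
  assumes "psd S"
  shows "\<exists>W. finite W \<and> W \<subseteq> range ((*v) S) \<and> (\<forall>X. S \<bullet> X = (\<Sum>w\<in>W. w \<bullet> (X *v w)))"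
  using assms
proof (induction "dim (range ((*v) S))" arbitrary: S rule: less_induct)
  case less
  have sym: "transpose S = S" using less.prems by (simp add: psd_def)
  show ?case
  proof (cases "\<forall>v. v \<bullet> (S *v v) = 0")
    case True
    then have "S = 0" using psd_eq_0_if_quadratic_form_0 less.prems by blast
    then show ?thesis by (intro exI[of _ "{}"]) simp
  next
    case False
    then obtain v where v: "v \<bullet> (S *v v) \<noteq> 0" by blast
    define a where "a = v \<bullet> (S *v v)"
    have a: "a > 0" using v less.prems unfolding a_def psd_def by (metis order_le_less)
    define w where "w = (1 / sqrt a) *\<^sub>R (S *v v)"
    define S' where "S' = S - outer w"
    have ww: "(w \<bullet> x) *\<^sub>R w = (((S *v v) \<bullet> x) / a) *\<^sub>R (S *v v)" for x
      using a by (simp add: w_def real_sqrt_mult_self divide_simps)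
    have S'x: "S' *v x = S *v x - (((S *v v) \<bullet> x) / a) *\<^sub>R (S *v v)" for x
      unfolding S'_def by (simp add: matrix_vector_mult_diff_rdistrib outer_mult ww)
    have tS': "transpose S' = S'"
      using sym by (simp add: S'_def transpose_def outer_def vec_eq_iff)
    have "0 \<le> x \<bullet> (S' *v x)" for x
    proof -
      have "(x \<bullet> (S *v v))\<^sup>2 \<le> (x \<bullet> (S *v x)) * a"
        using psd_Cauchy_Schwarz[OF less.prems] a_def by simp
      then show ?thesis unfolding S'x using a
        by (simp add: inner_diff_right field_simps power2_eq_square inner_commute)
    qed
    then have psd: "psd S'" using tS' by (simp add: psd_def)
    have S'v: "S' *v v = 0" unfolding S'x using a by (simp add: a_def inner_commute)
    have sub: "subspace (range ((*v) A))" for A :: "real^'n^'n"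
      by (simp add: linear_subspace_image)
    have le: "range ((*v) S') \<subseteq> range ((*v) S)"
    proof
      fix y assume "y \<in> range ((*v) S')"
      then obtain x where "y = S' *v x" by blast
      then have "y = S *v (x - (((S *v v) \<bullet> x) / a) *\<^sub>R v)"
        unfolding S'x by (simp add: matrix_vector_mult_diff_distrib matrix_vector_mult_scaleR)
      then show "y \<in> range ((*v) S)" by blast
    qed
    \<comment> \<open>This makes the inclusion of ranges strict: if \<open>S *v v = S' *v x\<close>,
      then symmetry gives \<open>a = (S' *v v) \<bullet> x = 0\<close>.\<close>
    have "S *v v \<notin> range ((*v) S')"
    proof
      assume "S *v v \<in> range ((*v) S')"
      then obtain x where "S *v v = S' *v x" by blast
      then have "a = (S' *v v) \<bullet> x" unfolding a_def using symmetric_matrix_inner[OF tS'] by metis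
      then show False using a S'v by simp
    qed
    then have "range ((*v) S') \<subset> range ((*v) S)" using le by blast
    then have "dim (range ((*v) S')) < dim (range ((*v) S))"
      using sub by (intro dim_psubset) (metis span_eq_iff)
    from less.hyps[OF this psd] obtain W where W: "finite W" "W \<subseteq> range ((*v) S')"
      "\<And>X. S' \<bullet> X = (\<Sum>w\<in>W. w \<bullet> (X *v w))" by blast
    have w: "w \<in> range ((*v) S)" unfolding w_def
      using sub[of S] by (simp add: subspace_mul)
    \<comment> \<open>The decomposition is indexed by a set, so the new vector must differ from the
      old ones to contribute a summand of its own.\<close>
    have "w \<notin> range ((*v) S')"
    proof
      assume "w \<in> range ((*v) S')"
      then have "sqrt a *\<^sub>R w \<in> range ((*v) S')" using sub[of S'] by (simp add: subspace_mul)
      then show False using a \<open>S *v v \<notin> range ((*v) S')\<close> by (simp add: w_def)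
    qed
    then have "w \<notin> W" using W(2) by blast
    moreover have "S \<bullet> X = w \<bullet> (X *v w) + S' \<bullet> X" for X
      by (simp add: S'_def inner_diff_left outer_inner)
    ultimately have "S \<bullet> X = (\<Sum>w\<in>insert w W. w \<bullet> (X *v w))" for X using W by simp
    then show ?thesis using W le w by (intro exI[of _ "insert w W"]) auto
  qed
qed

section \<open>The cone of positive semidefinite matrices supported on an index set\<close>

lemma psd_cone_iff_psd:
  fixes X :: "real^'n^'n"
  shows "X \<in> psd_cone I \<longleftrightarrow> X \<in> sym_space I \<and> psd X"
proof -
  have "psd X" if X: "X \<in> psd_cone I"
  proof -
    have sym: "transpose X = X" and out: "\<And>i j. i \<notin> I \<or> j \<notin> I \<Longrightarrow> X $ i $ j = 0"
      using X by (auto simp: psd_cone_def sym_space_def)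
    have "0 \<le> v \<bullet> (X *v v)" for v
    proof -
      \<comment> \<open>Entries of \<open>X\<close> outside \<open>I\<close> vanish, so truncating
        \<open>v\<close> to \<open>I\<close> leaves the quadratic form unchanged.\<close>
      define v' where "v' = (\<chi> i. if i \<in> I then v $ i else 0)"
      have 1: "X *v v = X *v v'"
        by (auto simp: matrix_vector_mult_def vec_eq_iff v'_def out intro!: sum.cong)
      have "v \<bullet> (X *v v') = v' \<bullet> (X *v v')"
        unfolding inner_vec_def
        by (intro sum.cong) (auto simp: v'_def matrix_vector_mult_def out)
      moreover have "v' \<in> vec_space I" by (simp add: v'_def vec_space_def)
      ultimately show ?thesis using X 1 by (simp add: psd_cone_def)
    qed
    then show ?thesis using sym by (simp add: psd_def)
  qed
  then show ?thesis by (auto simp: psd_cone_def psd_def)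
qed

text \<open>The rank-one matrices \<open>outer v\<close> suffice as tests, since pairing
  \<open>S\<close> with them evaluates its quadratic form.\<close>

lemma psd_cone_self_dual:
  assumes "S \<in> dual_cone (sym_space I) (psd_cone I)"
  shows "S \<in> psd_cone I"
proof -
  have "0 \<le> v \<bullet> (S *v v)" if "v \<in> vec_space I" for v
  proof -
    have "psd (outer v)" by (simp add: psd_def outer_mult inner_commute)
    moreover have "outer v \<in> sym_space I"
      using that transpose_outer[of v] by (auto simp: sym_space_def vec_space_def outer_def)
    ultimately have "outer v \<in> psd_cone I" by (simp add: psd_cone_iff_psd)
    then have "0 \<le> S \<bullet> outer v" using assms by (simp add: dual_cone_def)
    then show ?thesis by (simp add: outer_inner inner_commute[of S])
  qed
  then show ?thesis using assms by (simp add: dual_cone_def psd_cone_def)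
qed

text \<open>The way back from operator bounds to the Frobenius norm: by symmetry each row is the
  image of a basis vector, and the Euclidean norm of the row norms is at most their sum.\<close>

lemma norm_symmetric_matrix_le:
  fixes Z :: "real^'n^'n" and c :: real
  assumes "transpose Z = Z" "\<And>v. norm (Z *v v) \<le> c * norm v"
  shows "norm Z \<le> real CARD('n) * c"
proof -
  have "Z $ i = Z *v axis i 1" for i
    using assms(1) by (metis matrix_vector_mult_basis row_def row_transpose vec_lambda_eta)
  then have "norm (Z $ i) \<le> c" for i
    using assms(2)[of "axis i 1"] by simp
  then have "(\<Sum>i\<in>UNIV. norm (Z $ i)) \<le> (\<Sum>i\<in>(UNIV::'n set). c)" by (intro sum_mono)
  then show ?thesis using L2_set_le_sum[of UNIV "\<lambda>i. norm (Z $ i)"]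
    by (simp add: norm_vec_def)
qed

text \<open>The vectors \<open>u\<close> admitting such a constant form a subspace: sums are handled
  by nonnegativity of the form at \<open>u - v\<close>. It contains \<open>W\<close>, whose members
  have constant 1 because each contributes one summand of \<open>S \<bullet> X\<close>. The constant
  may depend on \<open>u\<close>, as only finitely many basis vectors matter later.\<close>

lemma psd_quadratic_form_le_on_span:
  fixes S :: "real^'n^'n"
  assumes W: "finite W" "\<And>X. S \<bullet> X = (\<Sum>w\<in>W. w \<bullet> (X *v w))" and u: "u \<in> span W"
  shows "\<exists>C\<ge>0. \<forall>X. psd X \<longrightarrow> u \<bullet> (X *v u) \<le> C * (S \<bullet> X)"
proof -
  have SX: "0 \<le> S \<bullet> X" if "psd X" for X
    unfolding W(2) using that by (intro sum_nonneg) (simp add: psd_def)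
  let ?P = "\<lambda>u. \<exists>C\<ge>0. \<forall>X. psd X \<longrightarrow> u \<bullet> (X *v u) \<le> C * (S \<bullet> X)"
  have sub: "subspace {u. ?P u}"
    unfolding subspace_def mem_Collect_eq
  proof (intro conjI allI ballI)
    show "?P 0" by (intro exI[of _ 0]) simp
  next
    fix u v assume "u \<in> {u. ?P u}" "v \<in> {u. ?P u}"
    then obtain C D where C: "C \<ge> 0" "\<And>X. psd X \<Longrightarrow> u \<bullet> (X *v u) \<le> C * (S \<bullet> X)"
      and D: "D \<ge> 0" "\<And>X. psd X \<Longrightarrow> v \<bullet> (X *v v) \<le> D * (S \<bullet> X)" by blast
    have "(u + v) \<bullet> (X *v (u + v)) \<le> (2 * C + 2 * D) * (S \<bullet> X)" if X: "psd X" for X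
    proof -
      have "0 \<le> (u - v) \<bullet> (X *v (u - v))" using X by (simp add: psd_def)
      then have "(u + v) \<bullet> (X *v (u + v)) \<le> 2 * (u \<bullet> (X *v u)) + 2 * (v \<bullet> (X *v v))"
        by (simp add: matrix_vector_mult_diff_distrib matrix_vector_right_distrib inner_diff_left
            inner_diff_right inner_add_left inner_add_right)
      also have "\<dots> \<le> (2 * C + 2 * D) * (S \<bullet> X)" using C(2)[OF X] D(2)[OF X]
        by (simp add: algebra_simps)
      finally show ?thesis .
    qed
    then show "?P (u + v)" using C(1) D(1) by (intro exI[of _ "2 * C + 2 * D"]) auto
  next
    fix c :: real and u assume "u \<in> {u. ?P u}"
    then obtain C where C: "C \<ge> 0" "\<And>X. psd X \<Longrightarrow> u \<bullet> (X *v u) \<le> C * (S \<bullet> X)" by blast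
    have "(c *\<^sub>R u) \<bullet> (X *v (c *\<^sub>R u)) \<le> (c\<^sup>2 * C) * (S \<bullet> X)" if X: "psd X" for X
      using mult_left_mono[OF C(2)[OF X], of "c\<^sup>2"]
      by (simp add: matrix_vector_mult_scaleR power2_eq_square algebra_simps)
    then show "?P (c *\<^sub>R u)" using C(1) by (intro exI[of _ "c\<^sup>2 * C"]) auto
  qed
  have "w \<in> {u. ?P u}" if "w \<in> W" for w
  proof -
    have "w \<bullet> (X *v w) \<le> 1 * (S \<bullet> X)" if "psd X" for X
      unfolding W(2) using that \<open>w \<in> W\<close> W(1)
      by (simp add: member_le_sum[where f = "\<lambda>w. w \<bullet> (X *v w)"] psd_def)
    then show ?thesis by (intro CollectI exI[of _ 1]) auto
  qed
  then have "span W \<subseteq> {u. ?P u}" using sub by (intro span_minimal) auto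
  then show ?thesis using u by blast
qed

lemma face_error_bound_psd_cone:
  fixes S :: "real^'n^'n"
  assumes "S \<in> dual_cone (sym_space I) (psd_cone I)"
  shows "face_error_bound (psd_cone I) S"
proof -
  have S: "S \<in> sym_space I" "psd S"
    using psd_cone_self_dual[OF assms] by (simp_all add: psd_cone_iff_psd)
  have pos: "\<And>X. X \<in> psd_cone I \<Longrightarrow> 0 \<le> S \<bullet> X" using assms by (simp add: dual_cone_def)
  obtain W where W: "finite W" "W \<subseteq> range ((*v) S)"
    "\<And>X. S \<bullet> X = (\<Sum>w\<in>W. w \<bullet> (X *v w))"
    using psd_rank_one_decomposition[OF S(2)] by blast
  \<comment> \<open>The projection is written with an orthonormal basis of \<open>span W\<close>,
    whose members inherit their bounds from \<open>W\<close> through the span.\<close>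
  obtain B where B: "pairwise orthogonal B" "\<And>b. b \<in> B \<Longrightarrow> norm b = 1" "independent B"
    "span B = span W"
    using orthonormal_basis_subspace[OF subspace_span[of W]] by metis
  have finB: "finite B" using B(3) by (rule independent_imp_finite)
  have B_span: "b \<in> span W" if "b \<in> B" for b using B(4) that by (metis span_base)
  have "subspace (vec_space I)" by (auto simp: subspace_def vec_space_def)
  \<comment> \<open>The decomposition keeps \<open>W\<close> inside the range of \<open>S\<close>
    for this purpose: the matrix P X P then stays supported on \<open>I\<close>.\<close>
  moreover have "W \<subseteq> vec_space I"
  proof -
    have "S *v x \<in> vec_space I" for x
      using S(1) by (auto simp: sym_space_def vec_space_def matrix_vector_mult_def)
    then show ?thesis using W(2) by blast
  qed
  ultimately have B_I: "b \<in> vec_space I" if "b \<in> B" for b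
    using B_span[OF that] span_minimal by blast
  have "\<forall>b. \<exists>C. b \<in> B \<longrightarrow> C \<ge> 0 \<and> (\<forall>X. psd X \<longrightarrow> b \<bullet> (X *v b) \<le> C * (S \<bullet> X))"
    using psd_quadratic_form_le_on_span[OF W(1) W(3)] B_span by metis
  then obtain C where C: "\<And>b. b \<in> B \<Longrightarrow> C b \<ge> 0"
    "\<And>b X. b \<in> B \<Longrightarrow> psd X \<Longrightarrow> b \<bullet> (X *v b) \<le> C b * (S \<bullet> X)" by metis
  define P where "P = mat 1 - (\<Sum>b\<in>B. outer b)"
  have Px: "P *v x = x - (\<Sum>b\<in>B. (b \<bullet> x) *\<^sub>R b)" for x
  proof -
    have "(\<Sum>b\<in>A. outer b) *v x = (\<Sum>b\<in>A. (b \<bullet> x) *\<^sub>R b)" if "finite A" for A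
      using that by induction (auto simp: outer_mult matrix_vector_mult_add_rdistrib)
    then show ?thesis using finB by (simp add: P_def matrix_vector_mult_diff_rdistrib)
  qed
  have tP: "transpose P = P"
  proof -
    have "transpose (\<Sum>b\<in>A. outer b) = (\<Sum>b\<in>A. outer b)" if "finite A" for A :: "(real^'n) set"
      using that by induction (auto simp: transpose_def vec_eq_iff outer_def)
    then show ?thesis using finB unfolding P_def
      by (simp add: transpose_def vec_eq_iff mat_def)
  qed
  have Pw: "P *v w = 0" if "w \<in> W" for w
    unfolding Px using orthonormal_basis_expand[OF B(1,2) _ finB, of w] that B(4)
    by (simp add: span_base inner_commute)
  define m where "m = real (card B)"
  define N where "N = real CARD('n)"
  \<comment> \<open>\<open>N\<close> passes from operator to Frobenius norm, \<open>2 + m\<close>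
    bounds the operator norm of \<open>X - Y\<close> in terms of \<open>c\<close> below, and the
    single \<open>m\<close> comes from bounding the square of a sum of \<open>m\<close>
    terms.\<close>
  define k where "k = (N * (2 + m))\<^sup>2 * m * (\<Sum>b\<in>B. C b)"
  have k: "0 \<le> k" unfolding k_def m_def using C(1) by (simp add: sum_nonneg)
  show ?thesis
  proof (rule face_error_boundI[OF k])
    fix X assume X: "X \<in> psd_cone I"
    then have Xp: "psd X" "transpose X = X" and XI: "X \<in> sym_space I"
      by (auto simp: psd_cone_iff_psd psd_def)
    define Y where "Y = P ** X ** P"
    have Yx: "Y *v x = P *v (X *v (P *v x))" for x
      by (simp add: Y_def matrix_vector_mul_assoc matrix_mul_assoc)
    have tY: "transpose Y = Y"
      by (simp add: Y_def matrix_transpose_mul tP Xp matrix_mul_assoc)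
    have qY: "x \<bullet> (Y *v x) = (P *v x) \<bullet> (X *v (P *v x))" for x
      unfolding Yx using symmetric_matrix_inner[OF tP] by simp
    have psdY: "psd Y" using tY Xp(1) by (simp add: psd_def qY)
    have out: "Y $ i $ j = 0" if "i \<notin> I" for i j
    proof -
      have "(X *v x) $ i = 0" for x
        using XI that by (simp add: sym_space_def matrix_vector_mult_def)
      moreover have "b $ i = 0" if "b \<in> B" for b
        using B_I[OF that] \<open>i \<notin> I\<close> by (simp add: vec_space_def)
      ultimately have "(Y *v axis j 1) $ i = 0" by (simp add: Yx Px[of "X *v _"])
      then show ?thesis by (simp add: matrix_vector_mult_basis column_def)
    qed
    then have "Y $ j $ i = 0" if "i \<notin> I" for i j
      using that tY by (metis transpose_def vec_lambda_beta)
    then have "Y \<in> sym_space I" using out tY by (auto simp: sym_space_def)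
    moreover have "S \<bullet> Y = 0" unfolding W(3) qY using Pw by simp
    ultimately have Y: "Y \<in> exposed_face (psd_cone I) S"
      using psdY by (simp add: exposed_face_def psd_cone_iff_psd)
    define c where "c = (\<Sum>b\<in>B. norm (X *v b))"
    have c: "c \<ge> 0" by (simp add: c_def sum_nonneg)
    \<comment> \<open>With Q = 1 - P one has X - P X P = Q X + P X Q, and both terms see only the
      vectors \<open>X *v b\<close>. The first contributes \<open>c\<close>, the second
      \<open>1 + m\<close> times \<open>c\<close>, using the crude bound \<open>m\<close> for the
      norm of Q.\<close>
    have "norm ((X - Y) *v x) \<le> ((2 + m) * c) * norm x" for x
    proof -
      let ?Q = "\<lambda>x. \<Sum>b\<in>B. (b \<bullet> x) *\<^sub>R b"
      have Q: "norm (?Q z) \<le> m * norm z" for z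
      proof -
        have "norm (?Q z) \<le> (\<Sum>b\<in>B. norm z)"
        proof (rule sum_norm_le)
          fix b assume "b \<in> B"
          then show "norm ((b \<bullet> z) *\<^sub>R b) \<le> norm z"
            using Cauchy_Schwarz_ineq2[of b z] B(2) by simp
        qed
        then show ?thesis by (simp add: m_def)
      qed
      have 1: "norm (?Q (X *v x)) \<le> c * norm x"
        unfolding c_def sum_distrib_right
      proof (rule sum_norm_le)
        fix b assume "b \<in> B"
        then show "norm ((b \<bullet> (X *v x)) *\<^sub>R b) \<le> norm (X *v b) * norm x"
          using Cauchy_Schwarz_ineq2[of "X *v b" x] B(2) symmetric_matrix_inner[OF Xp(2)] by simp
      qed
      have "X *v ?Q x = (\<Sum>b\<in>B. (b \<bullet> x) *\<^sub>R (X *v b))"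
        by (simp add: linear_sum[OF matrix_vector_mul_linear] matrix_vector_mult_scaleR)
      also have "norm \<dots> \<le> c * norm x"
        unfolding c_def sum_distrib_right
      proof (rule sum_norm_le)
        fix b assume "b \<in> B"
        then have "\<bar>b \<bullet> x\<bar> \<le> norm x" using Cauchy_Schwarz_ineq2[of b x] B(2) by simp
        then show "norm ((b \<bullet> x) *\<^sub>R (X *v b)) \<le> norm (X *v b) * norm x"
          using mult_right_mono[of "\<bar>b \<bullet> x\<bar>" "norm x" "norm (X *v b)"]
          by (simp add: mult.commute)
      qed
      finally have 2: "norm (X *v ?Q x) \<le> c * norm x" .
      have "norm (P *v (X *v ?Q x)) \<le> norm (X *v ?Q x) + m * norm (X *v ?Q x)"
        unfolding Px[of "X *v _"] using Q by (meson add_left_mono norm_triangle_ineq4 order_trans)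
      also have "\<dots> = (1 + m) * norm (X *v ?Q x)" by (simp add: algebra_simps)
      also have "\<dots> \<le> (1 + m) * (c * norm x)" using 2 by (intro mult_left_mono) (auto simp: m_def)
      finally have 3: "norm (P *v (X *v ?Q x)) \<le> (1 + m) * (c * norm x)" .
      have "(X - Y) *v x = X *v x - P *v (X *v (x - ?Q x))"
        by (simp add: matrix_vector_mult_diff_rdistrib Yx Px[of x])
      also have "\<dots> = (X *v x - P *v (X *v x)) + P *v (X *v ?Q x)"
        by (simp add: matrix_vector_mult_diff_distrib)
      also have "\<dots> = ?Q (X *v x) + P *v (X *v ?Q x)" by (simp add: Px[of "X *v x"])
      finally have "norm ((X - Y) *v x) \<le> c * norm x + (1 + m) * (c * norm x)"
        using 1 3 by (metis (no_types, lifting) add_mono norm_triangle_ineq order_trans)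
      then show ?thesis by (simp add: algebra_simps)
    qed
    moreover have "transpose (X - Y) = X - Y"
      using tY Xp(2) by (simp add: transpose_def vec_eq_iff)
    ultimately have "norm (X - Y) \<le> N * ((2 + m) * c)"
      unfolding N_def by (intro norm_symmetric_matrix_le)
    then have "(norm (X - Y))\<^sup>2 \<le> (N * ((2 + m) * c))\<^sup>2" by (simp add: power_mono)
    also have "\<dots> = (N * (2 + m))\<^sup>2 * c\<^sup>2" by (simp add: power_mult_distrib)
    also have "\<dots> \<le> (N * (2 + m))\<^sup>2 * ((\<Sum>b\<in>B. norm X * (C b * (S \<bullet> X))) * m)"
    proof (rule mult_left_mono)
      have "c\<^sup>2 \<le> (\<Sum>b\<in>B. (norm (X *v b))\<^sup>2) * m"
        unfolding c_def m_def by (rule sum_squared_le_sum_of_squares)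
      also have "\<dots> \<le> (\<Sum>b\<in>B. norm X * (C b * (S \<bullet> X))) * m"
      proof (intro mult_right_mono sum_mono)
        fix b assume "b \<in> B"
        then show "(norm (X *v b))\<^sup>2 \<le> norm X * (C b * (S \<bullet> X))"
          using psd_norm_matrix_vector_mult_sq[OF Xp(1), of b] C(2)[OF _ Xp(1), of b]
          by (meson mult_left_mono norm_ge_zero order_trans)
      qed (simp add: m_def)
      finally show "c\<^sup>2 \<le> (\<Sum>b\<in>B. norm X * (C b * (S \<bullet> X))) * m" .
    qed simp
    also have "\<dots> = k * norm X * (S \<bullet> X)"
      by (simp add: k_def sum_distrib_left sum_distrib_right algebra_simps)
    finally show "\<exists>Y\<in>exposed_face (psd_cone I) S. (norm (X - Y))\<^sup>2 \<le> k * norm X * (S \<bullet> X)"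
      using Y by blast
  qed
qed

lemma face_error_bound_listed_sym:
  assumes "listed_sym I K s"
  shows "face_error_bound K s"
proof -
  have "s \<in> dual_cone (sym_space I) (psd_cone I)" "K = psd_cone I"
    using assms unfolding listed_sym_def cone_setting_def by auto
  then show ?thesis using face_error_bound_psd_cone by blast
qed

section \<open>The exponential cone and its dual\<close>

lemma inner_3: "x \<bullet> y = x $ 1 * y $ 1 + x $ 2 * y $ 2 + x $ 3 * y $ 3" for x y :: "real^3"
  by (simp add: inner_vec_def sum_3)

lemma norm_sq_3: "(norm x)\<^sup>2 = (x $ 1)\<^sup>2 + (x $ 2)\<^sup>2 + (x $ 3)\<^sup>2" for x :: "real^3"
  unfolding power2_norm_eq_inner by (simp add: inner_3 power2_eq_square)

lemma vec3_eqI: "x $ 1 = y $ 1 \<Longrightarrow> x $ 2 = y $ 2 \<Longrightarrow> x $ 3 = y $ 3 \<Longrightarrow> x = y"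
  for x y :: "real^3"
  by (simp add: vec_eq_iff forall_3)

lemma face_error_bound_bij_3:
  fixes f :: "real^3 \<Rightarrow> real^3"
  assumes "face_error_bound K s" "linear f" "inj f"
    and "t > 0" "\<And>x. x \<in> K \<Longrightarrow> s' \<bullet> f x = t * (s \<bullet> x)" "\<And>x. x \<in> K \<Longrightarrow> 0 \<le> s \<bullet> x"
  shows "face_error_bound (f ` K) s'"
proof -
  obtain b where b: "b > 0" "\<And>x. b * norm x \<le> norm (f x)"
    using linear_inj_bounded_below_pos[OF assms(2,3)] by blast
  then have "norm x \<le> (1 / b) * norm (f x)" for x
    using b(2)[of x] by (simp add: field_simps)
  then show ?thesis
    using face_error_bound_linear_image[OF assms(1,2) _ assms(4,5,6)] by blast
qed

text \<open>The factor \<open>2 + \<bar>r\<bar>\<close> covers two regimes: the gap behaves like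
  half the square of \<open>r\<close> near 0, but only like \<open>- r\<close> for very negative
  \<open>r\<close>.\<close>

lemma exp_minus_one_minus_ge:
  fixes r :: real
  shows "r\<^sup>2 \<le> (2 + \<bar>r\<bar>) * (exp r - 1 - r)"
proof (cases "r \<ge> 0")
  case True
  have "r\<^sup>2 \<le> 2 * (exp r - 1 - r)" using exp_lower_Taylor_quadratic[OF True] by simp
  also have "\<dots> \<le> (2 + \<bar>r\<bar>) * (exp r - 1 - r)"
    using exp_ge_add_one_self[of r] by (intro mult_right_mono) (linarith, linarith)
  finally show ?thesis .
next
  case False
  \<comment> \<open>At \<open>x = - r\<close> this is the difference of the two sides; it vanishes
    at 0.\<close>
  define g where "g x = (2 + x) * exp (- x) + x - 2" for x :: real
  have "g 0 \<le> g (- r)"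
  proof (rule DERIV_nonneg_imp_nondecreasing[of 0 "- r" g])
    fix x :: real assume x: "0 \<le> x"
    have "(g has_real_derivative 1 - (1 + x) * exp (- x)) (at x)"
      unfolding g_def by (auto intro!: derivative_eq_intros simp: algebra_simps)
    moreover have "(1 + x) * exp (- x) \<le> exp x * exp (- x)"
      using exp_ge_add_one_self[of x] by (intro mult_right_mono) auto
    ultimately show "\<exists>y. (g has_real_derivative y) (at x) \<and> 0 \<le> y"
      by (intro exI[of _ "1 - (1 + x) * exp (- x)"]) (simp add: exp_minus)
  qed (use False in simp)
  then have "0 \<le> (2 - r) * exp r - r - 2" by (simp add: g_def)
  then show ?thesis using False by (simp add: power2_eq_square algebra_simps)
qed

text \<open>The preceding inequality at \<open>r = u / v\<close>, multiplied by the square of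
  \<open>v\<close>. This form is homogeneous and free of division, so it still makes sense at
  \<open>v = 0\<close>.\<close>

lemma scaled_exp_ge:
  fixes u v w :: real
  assumes "0 < v" "v * exp (u / v) \<le> w"
  shows "u\<^sup>2 \<le> (2 * v + \<bar>u\<bar>) * (w - v - u)"
proof -
  let ?r = "u / v"
  have "v\<^sup>2 * ?r\<^sup>2 \<le> v\<^sup>2 * ((2 + \<bar>?r\<bar>) * (exp ?r - 1 - ?r))"
    using exp_minus_one_minus_ge[of ?r] by (intro mult_left_mono) auto
  also have "\<dots> = (v * (2 + \<bar>?r\<bar>)) * (v * (exp ?r - 1 - ?r))"
    by (simp add: power2_eq_square)
  also have "v * (2 + \<bar>?r\<bar>) = 2 * v + \<bar>u\<bar>" using assms(1) by (simp add: algebra_simps)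
  also have "(2 * v + \<bar>u\<bar>) * (v * (exp ?r - 1 - ?r)) \<le> (2 * v + \<bar>u\<bar>) * (w - v - u)"
    using assms by (intro mult_left_mono) (simp_all add: algebra_simps)
  finally show ?thesis using assms(1) by (simp add: power_divide)
qed

text \<open>A polynomial consequence of Taylor's bound, which survives limits with \<open>v\<close>
  tending to 0, where \<open>u / v\<close> loses its meaning.\<close>

lemma scaled_exp_ge_sq:
  fixes u v w :: real
  assumes "0 < v" "v * exp (u / v) \<le> w" "0 \<le> u"
  shows "u\<^sup>2 \<le> 2 * v * w"
proof -
  have "(u / v)\<^sup>2 / 2 \<le> exp (u / v)"
    using exp_lower_Taylor_quadratic[of "u / v"] divide_nonneg_pos[OF assms(3,1)] by linarith
  then have "v * ((u / v)\<^sup>2 / 2) \<le> w" using assms by (smt (verit) mult_left_mono)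
  then show ?thesis using assms(1) by (simp add: field_simps power2_eq_square)
qed

lemma mem_exp_cone:
  "x \<in> exp_cone \<longleftrightarrow> (x $ 2 > 0 \<and> x $ 2 * exp (x $ 1 / x $ 2) \<le> x $ 3)
     \<or> (x $ 2 = 0 \<and> x $ 1 \<le> 0 \<and> 0 \<le> x $ 3)"
  (is "_ \<longleftrightarrow> ?int x \<or> ?bd x")
proof -
  define A where "A = {vector [u, v, w] :: real^3 | u v w. v * exp (u / v) \<le> w \<and> v > 0}"
  have mem_A: "x \<in> A \<longleftrightarrow> ?int x" for x
  proof
    show "x \<in> A \<Longrightarrow> ?int x" by (auto simp: A_def)
    assume "?int x"
    moreover have "x = vector [x $ 1, x $ 2, x $ 3]" by (rule vec3_eqI) simp_all
    ultimately show "x \<in> A" unfolding A_def by blast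
  qed
  have cl: "exp_cone = closure A" by (simp add: exp_cone_def A_def)
  have "?int x \<or> ?bd x" if x: "x \<in> closure A" for x
  proof -
    obtain f where f: "\<And>n. f n \<in> A" "f \<longlonglongrightarrow> x" using x by (meson closure_sequential)
    have lim: "(\<lambda>n. f n $ i) \<longlonglongrightarrow> x $ i" for i using f(2) by (rule tendsto_vec_nth)
    have int: "f n $ 2 > 0" "f n $ 2 * exp (f n $ 1 / f n $ 2) \<le> f n $ 3" for n
      using f(1)[of n] mem_A by auto
    have 2: "0 \<le> x $ 2" using int(1) by (intro LIMSEQ_le_const[OF lim]) (auto intro: less_imp_le)
    have "0 \<le> f n $ 3" for n using int[of n]
      by (meson exp_ge_zero less_imp_le mult_nonneg_nonneg order_trans)
    then have 3: "0 \<le> x $ 3" by (intro LIMSEQ_le_const[OF lim]) auto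
    show ?thesis
    proof (cases "x $ 2 = 0")
      case False
      then have "(\<lambda>n. f n $ 2 * exp (f n $ 1 / f n $ 2)) \<longlonglongrightarrow> x $ 2 * exp (x $ 1 / x $ 2)"
        by (intro tendsto_intros lim) auto
      then have "x $ 2 * exp (x $ 1 / x $ 2) \<le> x $ 3"
        by (rule LIMSEQ_le[OF _ lim]) (use int in auto)
      then show ?thesis using False 2 by simp
    next
      case True
      \<comment> \<open>In the limit the right side vanishes, which forces the positive part of the
        first coordinate to be 0.\<close>
      have "(max 0 (f n $ 1))\<^sup>2 \<le> 2 * f n $ 2 * f n $ 3" for n
        using scaled_exp_ge_sq[OF int[of n]] int[of n] \<open>0 \<le> f n $ 3\<close> by (auto simp: max_def)
      moreover have "(\<lambda>n. (max 0 (f n $ 1))\<^sup>2) \<longlonglongrightarrow> (max 0 (x $ 1))\<^sup>2"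
        by (intro tendsto_intros lim)
      moreover have "(\<lambda>n. 2 * f n $ 2 * f n $ 3) \<longlonglongrightarrow> 2 * x $ 2 * x $ 3"
        by (intro tendsto_intros lim)
      ultimately have "(max 0 (x $ 1))\<^sup>2 \<le> 2 * x $ 2 * x $ 3"
        by (metis (no_types, lifting) LIMSEQ_le)
      then show ?thesis using True 3 by (auto simp: max_def split: if_splits)
    qed
  qed
  moreover have "x \<in> closure A" if "?bd x" for x
  proof -
    \<comment> \<open>Boundary points are approached along (0, 1, 1): for u \<le> 0 \<le> w and e >
      0, e exp (u / e) \<le> e \<le> w + e.\<close>
    have lim: "(\<lambda>n. x + inverse (real (Suc n)) *\<^sub>R vector [0, 1, 1]) \<longlonglongrightarrow> x + 0 *\<^sub>R vector [0, 1, 1]"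
      by (intro tendsto_intros LIMSEQ_inverse_real_of_nat)
    have "x + inverse (real (Suc n)) *\<^sub>R vector [0, 1, 1] \<in> A" for n
    proof -
      define e where "e = inverse (real (Suc n))"
      have e: "e > 0" by (simp add: e_def)
      have "exp (x $ 1 / e) \<le> 1" using that e by (simp add: divide_nonpos_pos)
      then have "e * exp (x $ 1 / e) \<le> x $ 3 + e"
        using that e mult_left_mono[of "exp (x $ 1 / e)" 1 e] by linarith
      then show ?thesis using that e unfolding mem_A e_def[symmetric] by simp
    qed
    then show ?thesis using lim unfolding closure_sequential
      by (intro exI[of _ "\<lambda>n. x + inverse (real (Suc n)) *\<^sub>R vector [0, 1, 1]"]) auto
  qed
  ultimately show ?thesis using mem_A closure_subset cl by blast
qed

lemma exp_cone_nonneg: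
  assumes "x \<in> exp_cone"
  shows "0 \<le> x $ 2" "0 \<le> x $ 3" "(max 0 (x $ 1))\<^sup>2 \<le> 2 * x $ 2 * x $ 3"
    "(x $ 1)\<^sup>2 \<le> (2 * x $ 2 + \<bar>x $ 1\<bar>) * (x $ 3 - x $ 2 - x $ 1)"
    "0 \<le> x $ 3 - x $ 2 - x $ 1"
proof -
  consider "x $ 2 > 0" "x $ 2 * exp (x $ 1 / x $ 2) \<le> x $ 3"
    | "x $ 2 = 0" "x $ 1 \<le> 0" "0 \<le> x $ 3" using assms mem_exp_cone by blast
  note c = this
  show 2: "0 \<le> x $ 2" by (rule c) auto
  show 3: "0 \<le> x $ 3" by (rule c) (auto, meson exp_ge_zero less_imp_le mult_nonneg_nonneg order_trans)
  show "(max 0 (x $ 1))\<^sup>2 \<le> 2 * x $ 2 * x $ 3"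
    by (rule c) (use scaled_exp_ge_sq[of "x $ 2" "x $ 1" "x $ 3"] 2 3 in \<open>auto simp: max_def\<close>)
  show "(x $ 1)\<^sup>2 \<le> (2 * x $ 2 + \<bar>x $ 1\<bar>) * (x $ 3 - x $ 2 - x $ 1)"
  proof (rule c)
    assume "x $ 2 = 0" "x $ 1 \<le> 0" "0 \<le> x $ 3"
    then show ?thesis
      using mult_left_mono[of "- x $ 1" "x $ 3 - x $ 1" "- x $ 1"] by (simp add: power2_eq_square)
  qed (rule scaled_exp_ge)
  show "0 \<le> x $ 3 - x $ 2 - x $ 1"
  proof (rule c)
    assume a: "x $ 2 > 0" "x $ 2 * exp (x $ 1 / x $ 2) \<le> x $ 3"
    have "x $ 2 * (1 + x $ 1 / x $ 2) \<le> x $ 2 * exp (x $ 1 / x $ 2)"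
      using a by (intro mult_left_mono) auto
    then show ?thesis using a by (simp add: algebra_simps)
  qed auto
qed

lemma exp_cone_scaled: "c *\<^sub>R x \<in> exp_cone" if "x \<in> exp_cone" "0 \<le> c"
proof (cases "c = 0")
  case False
  then show ?thesis using that unfolding mem_exp_cone
    by (auto simp: mult_nonneg_nonpos mult.assoc intro!: mult_left_mono)
qed (simp add: mem_exp_cone)

text \<open>An automorphism of the cone. For \<open>\<alpha> = ln (- s $ 1 / s $ 3)\<close> it takes a dual vector \<open>s\<close> with
  \<open>s $ 1 < 0\<close> to a multiple of some \<open>(-1, b, 1)\<close>, where \<open>b = -1\<close> exactly if the face is a ray.\<close>

definition exp_shift :: "real \<Rightarrow> real^3 \<Rightarrow> real^3" where
  "exp_shift \<alpha> x = vector [x $ 1 + \<alpha> * x $ 2, x $ 2, exp \<alpha> * x $ 3]"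

lemma exp_shift_simps [simp]:
  "exp_shift \<alpha> x $ 1 = x $ 1 + \<alpha> * x $ 2" "exp_shift \<alpha> x $ 2 = x $ 2"
  "exp_shift \<alpha> x $ 3 = exp \<alpha> * x $ 3"
  by (simp_all add: exp_shift_def)

lemma linear_exp_shift: "linear (exp_shift \<alpha>)"
  by (rule linearI) (auto intro!: vec3_eqI simp: algebra_simps)

lemma exp_shift_inverse: "exp_shift \<alpha> (exp_shift (- \<alpha>) x) = x"
  by (rule vec3_eqI) (simp_all add: exp_minus)

lemma exp_shift_exp_cone: "exp_shift \<alpha> ` exp_cone = exp_cone"
proof -
  have 1: "exp_shift \<alpha> x \<in> exp_cone" if "x \<in> exp_cone" for \<alpha> x
  proof (cases "x $ 2 = 0")
    case False
    then have "x $ 2 > 0" "x $ 2 * exp (x $ 1 / x $ 2) \<le> x $ 3" using that by (auto simp: mem_exp_cone)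
    then show ?thesis
      by (simp add: mem_exp_cone add_divide_distrib exp_add)
  qed (use that in \<open>simp add: mem_exp_cone\<close>)
  show ?thesis
  proof
    show "exp_shift \<alpha> ` exp_cone \<subseteq> exp_cone" using 1 by blast
    show "exp_cone \<subseteq> exp_shift \<alpha> ` exp_cone"
    proof
      fix x assume "x \<in> exp_cone"
      then have "exp_shift (- \<alpha>) x \<in> exp_cone" by (rule 1)
      then show "x \<in> exp_shift \<alpha> ` exp_cone" using exp_shift_inverse by (metis image_eqI)
    qed
  qed
qed

text \<open>Pairing \<open>s\<close> with the curve (t, 1, exp t) gives
  \<open>s $ 1 * t + s $ 2 + s $ 3 * exp t\<close>, which for \<open>s $ 1 < 0 < s $ 3\<close> is
  minimal at the logarithm in the statement; this yields necessity. For sufficiency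
  \<open>exp_shift\<close> reduces to the normal (-1, -1, 1).\<close>

lemma mem_dual_exp_cone:
  "s \<in> dual_cone UNIV exp_cone \<longleftrightarrow>
     (s $ 1 < 0 \<and> 0 < s $ 3 \<and> s $ 1 - s $ 1 * ln (- s $ 1 / s $ 3) \<le> s $ 2)
     \<or> (s $ 1 = 0 \<and> 0 \<le> s $ 2 \<and> 0 \<le> s $ 3)"
  (is "_ \<longleftrightarrow> ?int \<or> ?bd")
proof
  assume "s \<in> dual_cone UNIV exp_cone"
  then have s: "0 \<le> s $ 1 * x $ 1 + s $ 2 * x $ 2 + s $ 3 * x $ 3" if "x \<in> exp_cone" for x
    using that by (auto simp: dual_cone_def inner_3)
  have "s $ 1 \<le> 0" using s[of "vector [-1, 0, 0]"] by (simp add: mem_exp_cone)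
  moreover have 3: "0 \<le> s $ 3" using s[of "vector [0, 0, 1]"] by (simp add: mem_exp_cone)
  have e: "0 \<le> s $ 1 * t + s $ 2 + s $ 3 * exp t" for t
    using s[of "vector [t, 1, exp t]"] by (simp add: mem_exp_cone)
  show "?int \<or> ?bd"
  proof (cases "s $ 1 = 0")
    case True
    have "0 \<le> s $ 2"
    proof (rule ccontr)
      assume neg: "\<not> 0 \<le> s $ 2"
      \<comment> \<open>Chosen so that \<open>s $ 3 * exp t \<le> - s $ 2 / 2\<close>, which makes
        the pairing negative; the summand 1 avoids division by 0.\<close>
      define t where "t = ln (- s $ 2 / (2 * (s $ 3 + 1)))"
      have "- s $ 2 / (2 * (s $ 3 + 1)) > 0" using neg 3 by (intro divide_pos_pos) auto
      then have "s $ 3 * exp t = s $ 3 / (s $ 3 + 1) * (- s $ 2 / 2)" by (simp add: t_def)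
      also have "\<dots> \<le> 1 * (- s $ 2 / 2)"
        using neg 3 by (intro mult_right_mono) auto
      finally show False using e[of t] True neg by simp
    qed
    then show ?thesis using True 3 by simp
  next
    case False
    then have 1: "s $ 1 < 0" using \<open>s $ 1 \<le> 0\<close> by simp
    have "s $ 3 \<noteq> 0"
    proof
      assume "s $ 3 = 0"
      then show False using e[of "- (s $ 2 + 1) / s $ 1"] 1 by simp
    qed
    then have 3: "s $ 3 > 0" using 3 by simp
    have "- s $ 1 / s $ 3 > 0" using 1 3 by (intro divide_pos_pos) auto
    then have "s $ 3 * exp (ln (- s $ 1 / s $ 3)) = - s $ 1" using 3 by simp
    then show ?thesis using e[of "ln (- s $ 1 / s $ 3)"] 1 3 by simp
  qed
next
  assume *: "?int \<or> ?bd"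
  have "0 \<le> s \<bullet> x" if x: "x \<in> exp_cone" for x
  proof (cases "s $ 1 = 0")
    case True
    then show ?thesis using * exp_cone_nonneg(1,2)[OF x] by (auto simp: inner_3)
  next
    case False
    define \<alpha> where "\<alpha> = ln (- s $ 1 / s $ 3)"
    have 1: "s $ 1 < 0" "0 < s $ 3" "s $ 1 - s $ 1 * \<alpha> \<le> s $ 2"
      using * False by (auto simp: \<alpha>_def)
    have ea: "s $ 3 * exp \<alpha> = - s $ 1" using 1 by (simp add: \<alpha>_def divide_neg_pos)
    obtain y where y: "y \<in> exp_cone" "x = exp_shift \<alpha> y" using x exp_shift_exp_cone by blast
    have "(s $ 1 - s $ 1 * \<alpha>) * y $ 2 \<le> s $ 2 * y $ 2"
      using 1 exp_cone_nonneg(1)[OF y(1)] by (intro mult_right_mono) auto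
    moreover have "s $ 3 * (exp \<alpha> * y $ 3) = - s $ 1 * y $ 3" using ea by (metis mult.assoc)
    moreover have "0 \<le> - s $ 1 * (y $ 3 - y $ 2 - y $ 1)"
      using 1 exp_cone_nonneg(5)[OF y(1)] by (intro mult_nonneg_nonneg) auto
    ultimately show ?thesis by (simp add: y(2) inner_3 algebra_simps)
  qed
  then show "s \<in> dual_cone UNIV exp_cone" by (simp add: dual_cone_def)
qed

section \<open>Error bounds for the faces of the exponential cone\<close>

lemma face_error_bound_exp_cone_ray: "face_error_bound exp_cone (vector [-1, -1, 1])"
  (is "face_error_bound _ ?s")
proof (rule face_error_boundI[of 13])
  fix x assume x: "x \<in> exp_cone"
  note x_pos = exp_cone_nonneg[OF x]
  define g where "g = x $ 3 - x $ 2 - x $ 1"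
  have sx: "?s \<bullet> x = g" by (simp add: inner_3 g_def)
  have n: "\<bar>x $ i\<bar> \<le> norm x" for i by (rule component_le_norm_cart)
  \<comment> \<open>The face is the ray of (0, 1, 1); \<open>y\<close> keeps the middle coordinate
    of \<open>x\<close>.\<close>
  define y :: "real^3" where "y = vector [0, x $ 2, x $ 2]"
  have "y \<in> exp_cone" using x_pos(1) by (cases "x $ 2 = 0") (auto simp: y_def mem_exp_cone)
  then have y: "y \<in> exposed_face exp_cone ?s" by (simp add: exposed_face_def inner_3 y_def)
  have "g \<le> 2 * norm x" unfolding g_def
    using n[of 1] n[of 3] x_pos(1) by linarith
  then have gg: "g\<^sup>2 \<le> 2 * norm x * g"
    using x_pos(5) by (simp add: power2_eq_square mult_right_mono g_def)
  have "(x $ 1)\<^sup>2 \<le> (2 * x $ 2 + \<bar>x $ 1\<bar>) * g" using x_pos(4) by (simp add: g_def)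
  also have "\<dots> \<le> (3 * norm x) * g"
    using n[of 1] n[of 2] x_pos(5) by (intro mult_right_mono) (auto simp: g_def)
  finally have uu: "(x $ 1)\<^sup>2 \<le> 3 * norm x * g" .
  have "(norm (x - y))\<^sup>2 = (x $ 1)\<^sup>2 + (g + x $ 1)\<^sup>2"
    by (simp add: norm_sq_3 y_def g_def)
  also have "\<dots> \<le> 3 * (x $ 1)\<^sup>2 + 2 * g\<^sup>2"
    using zero_le_power2[of "g - x $ 1"] by (simp add: power2_eq_square algebra_simps)
  \<comment> \<open>The constant is 3 * 3 + 2 * 2, from \<open>uu\<close> and
    \<open>gg\<close>.\<close>
  also have "\<dots> \<le> 13 * norm x * (?s \<bullet> x)"
    unfolding sx using uu gg by linarith
  finally show "\<exists>y\<in>exposed_face exp_cone ?s. (norm (x - y))\<^sup>2 \<le> 13 * norm x * (?s \<bullet> x)"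
    using y by blast
qed simp

text \<open>The face lies in the plane v = 0 with u \<le> 0, and in addition w = 0 when c > 0. The
  positive part of u is small because its square is at most 2 v w.\<close>

lemma face_error_bound_exp_cone_boundary:
  assumes b: "0 < b" and c: "0 \<le> c"
  shows "face_error_bound exp_cone (vector [0, b, c])" (is "face_error_bound _ ?s")
proof -
  \<comment> \<open>The square of v and that of the positive part of u together cost
    \<open>3 * norm x\<close> times v, hence \<open>3 / b\<close>; \<open>1 / c\<close> pays for the
    square of w when w has to be removed.\<close>
  define k where "k = 3 / b + (if c = 0 then 0 else 1 / c)"
  have kb: "3 \<le> k * b" using b c by (auto simp: k_def field_simps)
  have kc: "1 \<le> k * c" if "c \<noteq> 0" using b c that by (auto simp: k_def field_simps)
  show ?thesis
  proof (rule face_error_boundI[of k])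
    show "0 \<le> k" using b c by (simp add: k_def)
    fix x assume x: "x \<in> exp_cone"
    note x_pos = exp_cone_nonneg[OF x]
    have n: "\<bar>x $ i\<bar> \<le> norm x" for i by (rule component_le_norm_cart)
    have n': "x $ 2 \<le> norm x" "x $ 3 \<le> norm x" using n[of 2] n[of 3] by auto
    define y :: "real^3" where "y = vector [min (x $ 1) 0, 0, if c = 0 then x $ 3 else 0]"
    have "y \<in> exp_cone" using x_pos(2) by (simp add: y_def mem_exp_cone)
    then have y: "y \<in> exposed_face exp_cone ?s" by (simp add: exposed_face_def inner_3 y_def)
    have "x $ 1 - min (x $ 1) 0 = max 0 (x $ 1)" by simp
    then have "(norm (x - y))\<^sup>2 = (max 0 (x $ 1))\<^sup>2 + (x $ 2)\<^sup>2 + (if c = 0 then 0 else (x $ 3)\<^sup>2)"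
      by (simp add: norm_sq_3 y_def)
    also have "\<dots> \<le> 3 * (norm x * x $ 2) + (if c = 0 then 0 else norm x * x $ 3)"
      using x_pos(3) mult_right_mono[OF n'(1) x_pos(1)] mult_right_mono[OF n'(2) x_pos(1)]
        mult_right_mono[OF n'(2) x_pos(2)]
      by (auto simp: power2_eq_square algebra_simps)
    also have "\<dots> \<le> (k * b) * (norm x * x $ 2) + (k * c) * (norm x * x $ 3)"
    proof (rule add_mono)
      show "3 * (norm x * x $ 2) \<le> (k * b) * (norm x * x $ 2)"
        using kb x_pos by (intro mult_right_mono) auto
      show "(if c = 0 then 0 else norm x * x $ 3) \<le> (k * c) * (norm x * x $ 3)"
        using mult_right_mono[OF kc, of "norm x * x $ 3"] x_pos by auto
    qed
    also have "\<dots> = k * norm x * (?s \<bullet> x)" by (simp add: inner_3 algebra_simps)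
    finally show "\<exists>y\<in>exposed_face exp_cone ?s. (norm (x - y))\<^sup>2 \<le> k * norm x * (?s \<bullet> x)"
      using y by blast
  qed
qed

lemma face_error_bound_exp_cone:
  assumes s: "s \<in> dual_cone UNIV exp_cone" and ns: "\<not> (s $ 1 = 0 \<and> s $ 2 = 0 \<and> 0 < s $ 3)"
  shows "face_error_bound exp_cone s"
proof -
  have pos: "\<And>x. x \<in> exp_cone \<Longrightarrow> 0 \<le> s \<bullet> x" using s by (simp add: dual_cone_def)
  show ?thesis
  proof (cases "s $ 1 = 0")
    case True
    then have s23: "0 \<le> s $ 2" "0 \<le> s $ 3" using s by (auto simp: mem_dual_exp_cone)
    have s_eq: "s = vector [0, s $ 2, s $ 3]" using True by (intro vec3_eqI) simp_all
    show ?thesis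
    proof (cases "s $ 2 = 0")
      case True
      then have "s = 0" using ns s23 \<open>s $ 1 = 0\<close> by (intro vec3_eqI) auto
      then show ?thesis by (intro face_error_bound_full_face) (simp add: exposed_face_def)
    next
      case False
      then show ?thesis using face_error_bound_exp_cone_boundary[of "s $ 2" "s $ 3"] s23 s_eq by simp
    qed
  next
    case False
    define \<alpha> where "\<alpha> = ln (- s $ 1 / s $ 3)"
    have 1: "s $ 1 < 0" "0 < s $ 3" "s $ 1 - s $ 1 * \<alpha> \<le> s $ 2"
      using s False by (auto simp: \<alpha>_def mem_dual_exp_cone)
    have ea: "s $ 3 * exp \<alpha> = - s $ 1" using 1 by (simp add: \<alpha>_def divide_neg_pos)
    have ea': "s $ 3 * (exp \<alpha> * z) = - s $ 1 * z" for z using ea by (metis mult.assoc)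
    \<comment> \<open>Pulled back by the shift, \<open>s\<close> is a nonnegative combination of
      (-1, -1, 1) and (0, 1, 0). If the second coefficient is 0, the ray case remains; if it is
      positive, both terms vanish on the face, which is then {0}.\<close>
    have s_shift: "s \<bullet> exp_shift \<alpha> x
        = - s $ 1 * (x $ 3 - x $ 2 - x $ 1) + (s $ 2 - (s $ 1 - s $ 1 * \<alpha>)) * x $ 2" for x
      by (simp add: inner_3 ea') (simp add: algebra_simps)
    show ?thesis
    proof (cases "s $ 2 = s $ 1 - s $ 1 * \<alpha>")
      case True
      have inj: "inj (exp_shift \<alpha>)"
        by (rule inj_on_inverseI[of _ "exp_shift (- \<alpha>)"]) (metis exp_shift_inverse minus_minus)
      have "face_error_bound (exp_shift \<alpha> ` exp_cone) s"
        using face_error_bound_exp_cone_ray linear_exp_shift inj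
      proof (rule face_error_bound_bij_3)
        show "0 < - s $ 1" using 1 by simp
        show "s \<bullet> exp_shift \<alpha> x = - s $ 1 * (vector [-1, -1, 1] \<bullet> x)" if "x \<in> exp_cone" for x
          using s_shift[of x] True by (simp add: inner_3)
        show "0 \<le> vector [-1, -1, 1] \<bullet> x" if "x \<in> exp_cone" for x
          using exp_cone_nonneg(5)[OF that] by (simp add: inner_3)
      qed
      then show ?thesis by (simp add: exp_shift_exp_cone)
    next
      case ne: False
      have "x = 0" if x: "x \<in> exp_cone" "s \<bullet> x = 0" for x
      proof -
        obtain y where y: "y \<in> exp_cone" "x = exp_shift \<alpha> y" using x exp_shift_exp_cone by blast
        note y_pos = exp_cone_nonneg[OF y(1)]
        have "0 \<le> - s $ 1 * (y $ 3 - y $ 2 - y $ 1)"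
          using 1 y_pos(5) by (intro mult_nonneg_nonneg) auto
        moreover have "0 \<le> (s $ 2 - (s $ 1 - s $ 1 * \<alpha>)) * y $ 2"
          using 1 y_pos(1) by (intro mult_nonneg_nonneg) auto
        ultimately have "- s $ 1 * (y $ 3 - y $ 2 - y $ 1) = 0"
          "(s $ 2 - (s $ 1 - s $ 1 * \<alpha>)) * y $ 2 = 0"
          using x(2) s_shift[of y] unfolding y(2) by linarith+
        then have "y $ 3 - y $ 2 - y $ 1 = 0" "y $ 2 = 0" using 1 ne by auto
        moreover from this have "(y $ 1)\<^sup>2 \<le> 0" using y_pos(4) by simp
        ultimately have "y = 0" by (intro vec3_eqI) auto
        then show ?thesis using y(2) linear_0[OF linear_exp_shift] by simp
      qed
      moreover have "0 \<in> exp_cone" by (simp add: mem_exp_cone)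
      ultimately have "exposed_face exp_cone s = {0}" by (auto simp: exposed_face_def)
      moreover have "closed exp_cone" by (simp add: exp_cone_def)
      moreover have "conic exp_cone" using exp_cone_scaled by (simp add: conic_def)
      ultimately show ?thesis using pos by (intro face_error_bound_trivial_face)
    qed
  qed
qed

text \<open>For \<open>a < 0\<close> the vector \<open>(a, b, c)\<close> is dual iff \<open>- a * exp ((a - b) / (- a)) \<le> c\<close>, that is, iff
  \<open>(a - b, - a, c)\<close> lies in the cone. The following is the inverse of this substitution.\<close>

definition exp_dual_map :: "real^3 \<Rightarrow> real^3" where
  "exp_dual_map x = vector [- x $ 2, - x $ 1 - x $ 2, x $ 3]"

lemma exp_dual_map_simps [simp]:
  "exp_dual_map x $ 1 = - x $ 2" "exp_dual_map x $ 2 = - x $ 1 - x $ 2" "exp_dual_map x $ 3 = x $ 3"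
  by (simp_all add: exp_dual_map_def)

lemma exp_dual_map_exp_cone: "exp_dual_map ` exp_cone = dual_cone UNIV exp_cone"
proof -
  have iff: "exp_dual_map x \<in> dual_cone UNIV exp_cone \<longleftrightarrow> x \<in> exp_cone" for x
  proof (cases "x $ 2 > 0")
    case True
    have "- x $ 2 + x $ 2 * ln (x $ 2 / x $ 3) \<le> - x $ 1 - x $ 2 \<longleftrightarrow>
        x $ 2 * exp (x $ 1 / x $ 2) \<le> x $ 3" if "x $ 3 > 0"
    proof -
      have "- x $ 2 + x $ 2 * ln (x $ 2 / x $ 3) \<le> - x $ 1 - x $ 2 \<longleftrightarrow>
          x $ 1 / x $ 2 \<le> ln (x $ 3 / x $ 2)"
        using True that by (simp add: ln_div field_simps)
      also have "\<dots> \<longleftrightarrow> exp (x $ 1 / x $ 2) \<le> x $ 3 / x $ 2"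
        using True that by (simp add: ln_ge_iff)
      finally show ?thesis using True by (simp add: field_simps)
    qed
    moreover have "x $ 3 > 0" if "x $ 2 * exp (x $ 1 / x $ 2) \<le> x $ 3"
      using that True by (meson exp_gt_zero less_le_trans mult_pos_pos)
    ultimately show ?thesis using True by (auto simp: mem_dual_exp_cone mem_exp_cone)
  qed (auto simp: mem_dual_exp_cone mem_exp_cone)
  have "s \<in> exp_dual_map ` exp_cone" if "s \<in> dual_cone UNIV exp_cone" for s
  proof -
    have "s = exp_dual_map (vector [s $ 1 - s $ 2, - s $ 1, s $ 3])"
      by (rule vec3_eqI) simp_all
    then show ?thesis using iff that by (metis image_eqI)
  qed
  then show ?thesis using iff by auto
qed

text \<open>Transport along \<open>exp_dual_map\<close>, with \<open>r\<close> the adjoint map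
  applied to \<open>s\<close>. The adjoint fixes (0, 0, 1), so the excluded ray is the same for both
  cones.\<close>

lemma face_error_bound_dual_exp_cone:
  assumes s: "s \<in> dual_cone UNIV (dual_cone UNIV exp_cone)"
    and ns: "\<not> (s $ 1 = 0 \<and> s $ 2 = 0 \<and> 0 < s $ 3)"
  shows "face_error_bound (dual_cone UNIV exp_cone) s"
proof -
  define r :: "real^3" where "r = vector [- s $ 2, - s $ 1 - s $ 2, s $ 3]"
  have r: "s \<bullet> exp_dual_map x = r \<bullet> x" for x
    by (simp add: inner_3 r_def algebra_simps)
  have lin: "linear exp_dual_map" by (rule linearI) (auto intro!: vec3_eqI simp: algebra_simps)
  have inj: "inj exp_dual_map"
  proof (rule injI)
    fix x y assume "exp_dual_map x = exp_dual_map y"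
    then have "exp_dual_map x $ i = exp_dual_map y $ i" for i by simp
    from this[of 1] this[of 2] this[of 3] show "x = y" by (intro vec3_eqI) auto
  qed
  have pos: "0 \<le> r \<bullet> x" if "x \<in> exp_cone" for x
  proof -
    have "exp_dual_map x \<in> dual_cone UNIV exp_cone" using that exp_dual_map_exp_cone by blast
    then have "0 \<le> s \<bullet> exp_dual_map x" using s by (simp add: dual_cone_def[of _ "dual_cone UNIV exp_cone"])
    then show ?thesis by (simp add: r)
  qed
  then have "r \<in> dual_cone UNIV exp_cone" by (simp add: dual_cone_def)
  moreover have "\<not> (r $ 1 = 0 \<and> r $ 2 = 0 \<and> 0 < r $ 3)" using ns by (auto simp: r_def)
  ultimately have "face_error_bound exp_cone r" by (rule face_error_bound_exp_cone)
  then have "face_error_bound (exp_dual_map ` exp_cone) s"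
    using lin inj by (rule face_error_bound_bij_3[where t = 1]) (use r pos in auto)
  then show ?thesis by (simp add: exp_dual_map_exp_cone)
qed

section \<open>Strict complementarity and the exceptional ray\<close>

lemma rel_interior_extend:
  fixes s t :: "'a::euclidean_space"
  assumes "s \<in> rel_interior S" "t \<in> S"
  shows "\<exists>e>0. s + e *\<^sub>R (s - t) \<in> S"
proof -
  obtain d where d: "d > 0" "cball s d \<inter> affine hull S \<subseteq> S" and "s \<in> S"
    using assms(1) by (auto simp: mem_rel_interior_cball)
  \<comment> \<open>The summand 1 avoids division by 0 when \<open>s = t\<close> and still keeps the
    prolonged point in the ball.\<close>
  define e where "e = d / (norm (s - t) + 1)"
  have "norm (s - t) + 1 > 0" by (simp add: add_nonneg_pos)
  then have e: "e > 0" "e * norm (s - t) \<le> d"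
    using d by (auto simp: e_def divide_simps)
  have "(1 + e) *\<^sub>R s + (- e) *\<^sub>R t \<in> affine hull S"
    using \<open>s \<in> S\<close> assms(2) by (intro mem_affine) (auto intro: hull_inc)
  moreover have "(1 + e) *\<^sub>R s + (- e) *\<^sub>R t = s + e *\<^sub>R (s - t)"
    by (simp add: algebra_simps)
  moreover have "s + e *\<^sub>R (s - t) \<in> cball s d" using e by (simp add: dist_norm)
  ultimately show ?thesis using d(2) e(1) by auto
qed

text \<open>A point \<open>x\<close> of the cone orthogonal to \<open>s\<close> has its last two
  coordinates 0, so (0, 1, 0) lies in the dual face of \<open>x\<close>. Prolonging the segment from
  there beyond \<open>s\<close> makes the middle coordinate negative.\<close>

lemma not_strictly_complementary_exp_cone:
  assumes s: "s $ 1 = 0" "s $ 2 = 0" "0 < s $ 3"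
  shows "\<not> strictly_complementary UNIV exp_cone s"
proof
  assume "strictly_complementary UNIV exp_cone s"
  then obtain x where x: "x \<in> exp_cone" "x \<bullet> s = 0"
    "s \<in> rel_interior (exposed_face (dual_cone UNIV exp_cone) x)"
    unfolding strictly_complementary_def by blast
  have x3: "x $ 3 = 0" using x(2) s by (simp add: inner_3)
  then have x2: "x $ 2 = 0" using x(1)
    by (auto simp: mem_exp_cone) (smt (verit) exp_gt_zero mult_pos_pos)
  have "vector [0, 1, 0] \<in> exposed_face (dual_cone UNIV exp_cone) x"
    using x2 by (simp add: exposed_face_def mem_dual_exp_cone inner_3)
  from rel_interior_extend[OF x(3) this] obtain e where "e > 0"
    "s + e *\<^sub>R (s - vector [0, 1, 0]) \<in> dual_cone UNIV exp_cone"
    by (auto simp: exposed_face_def)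
  then show False using s by (auto simp: mem_dual_exp_cone)
qed

text \<open>The analogous argument in the bidual, where knowing that it contains
  \<open>exp_cone\<close> is enough: the segment starts at (-1, 0, 0), and its prolongation beyond
  \<open>s\<close> gets a positive first and a zero middle coordinate.\<close>

lemma not_strictly_complementary_dual_exp_cone:
  assumes s: "s $ 1 = 0" "s $ 2 = 0" "0 < s $ 3"
  shows "\<not> strictly_complementary UNIV (dual_cone UNIV exp_cone) s"
proof
  let ?D = "dual_cone UNIV (dual_cone UNIV exp_cone)"
  assume "strictly_complementary UNIV (dual_cone UNIV exp_cone) s"
  then obtain x where x: "x \<in> dual_cone UNIV exp_cone" "x \<bullet> s = 0"
    "s \<in> rel_interior (exposed_face ?D x)"
    unfolding strictly_complementary_def by blast
  have x3: "x $ 3 = 0" using x(2) s by (simp add: inner_3)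
  then have x1: "x $ 1 = 0" using x(1) by (auto simp: mem_dual_exp_cone)
  have "vector [-1, 0, 0] \<in> exp_cone" by (simp add: mem_exp_cone)
  then have "vector [-1, 0, 0] \<in> ?D" by (auto simp: dual_cone_def inner_commute)
  then have "vector [-1, 0, 0] \<in> exposed_face ?D x"
    using x1 by (simp add: exposed_face_def inner_3)
  from rel_interior_extend[OF x(3) this] obtain e where e: "e > 0"
    "s + e *\<^sub>R (s - vector [-1, 0, 0]) \<in> ?D" (is "?z \<in> _")
    by (auto simp: exposed_face_def)
  define c where "c = min 1 (e / (2 * (1 + e) * s $ 3))"
  have ce: "e / (2 * (1 + e) * s $ 3) > 0" using e s by (intro divide_pos_pos mult_pos_pos) auto
  then have c: "c > 0" by (simp add: c_def)
  \<comment> \<open>Boundary vectors of the dual cone. Their middle entry is unbounded as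
    \<open>c\<close> tends to 0 but meets the zero of \<open>?z\<close>, so the pairing is
    \<open>- e + (1 + e) * s $ 3 * c\<close>, at most \<open>- e / 2\<close> by the choice of
    \<open>c\<close>.\<close>
  have "vector [-1, -1 + ln (1 / c), c] \<in> dual_cone UNIV exp_cone"
    using c by (simp add: mem_dual_exp_cone)
  then have "0 \<le> ?z \<bullet> vector [-1, -1 + ln (1 / c), c]" using e(2) by (auto simp: dual_cone_def)
  then have "e \<le> (1 + e) * s $ 3 * c" using s by (simp add: inner_3 algebra_simps)
  also have "\<dots> \<le> (1 + e) * s $ 3 * (e / (2 * (1 + e) * s $ 3))"
    using e s by (intro mult_left_mono) (auto simp: c_def)
  also have "\<dots> = (1 + e) * s $ 3 * e / ((1 + e) * s $ 3 * 2)" by (simp add: mult_ac)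
  also have "\<dots> = e / 2" using e s by (subst mult_divide_mult_cancel_left) auto
  finally show False using e by simp
qed

section \<open>Power cones and their duals\<close>

lemma weighted_arith_geo_mean:
  fixes u v p :: real
  assumes "0 < p" "p < 1" "0 \<le> u" "0 \<le> v"
  shows "u powr p * v powr (1 - p) \<le> p * u + (1 - p) * v"
proof (cases "u = 0 \<or> v = 0")
  case False
  then show ?thesis using Youngs_inequality_0[of p "1 - p" u v] assms by simp
qed (use assms in auto)

text \<open>The mean \<open>u\<^sup>p v\<^sup>1\<^sup>-\<^sup>p\<close> with \<open>p \<le> 1/2\<close> is a weighted geometric mean of \<open>\<surd>(u v)\<close> and \<open>v\<close>.\<close>

lemma arith_geo_mean_gap_half:
  fixes u v p :: real
  assumes p: "0 < p" "p \<le> 1 / 2" and uv: "0 \<le> u" "0 \<le> v"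
  shows "p * (sqrt u - sqrt v)\<^sup>2 \<le> p * u + (1 - p) * v - u powr p * v powr (1 - p)"
proof -
  have sq: "(sqrt u)\<^sup>2 = u" "(sqrt v)\<^sup>2 = v" using uv by simp_all
  have half: "sqrt u powr (2 * p) = u powr p" "sqrt v powr (2 * p) = v powr p"
    using uv by (simp_all add: powr_half_sqrt[symmetric] powr_powr)
  have "u powr p * v powr (1 - p) \<le> 2 * p * (sqrt u * sqrt v) + (1 - 2 * p) * v"
  proof (cases "p = 1 / 2")
    case True
    show ?thesis unfolding True using uv by (simp add: powr_half_sqrt)
  next
    case False
    have "u powr p * v powr (1 - p) = (sqrt u * sqrt v) powr (2 * p) * v powr (1 - 2 * p)"
    proof -
      have "v powr (1 - p) = v powr p * v powr (1 - 2 * p)" by (simp flip: powr_add)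
      then show ?thesis using uv half by (simp add: powr_mult)
    qed
    also have "\<dots> \<le> 2 * p * (sqrt u * sqrt v) + (1 - 2 * p) * v"
      using weighted_arith_geo_mean[of "2 * p" "sqrt u * sqrt v" v] p False uv by simp
    finally show ?thesis .
  qed
  \<comment> \<open>Subtracting this bound from the arithmetic mean leaves exactly \<open>p\<close>
    times the square of \<open>sqrt u - sqrt v\<close>.\<close>
  then show ?thesis using sq by (simp add: power2_eq_square algebra_simps)
qed

text \<open>Multiplying by the square of \<open>sqrt u + sqrt v\<close>, which is at most
  \<open>2 * (u + v)\<close>, removes the roots and gives a bound of degree 2. For
  \<open>p > 1 / 2\<close> the roles of \<open>u\<close> and \<open>v\<close> are exchanged.\<close>

lemma arith_geo_mean_gap:
  fixes u v p :: real
  assumes p: "0 < p" "p < 1" and uv: "0 \<le> u" "0 \<le> v"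
  shows "min p (1 - p) * (u - v)\<^sup>2 \<le> 2 * (u + v) * (p * u + (1 - p) * v - u powr p * v powr (1 - p))"
proof -
  have sq: "(sqrt u)\<^sup>2 = u" "(sqrt v)\<^sup>2 = v" using uv by simp_all
  have 1: "min p (1 - p) * (sqrt u - sqrt v)\<^sup>2 \<le> p * u + (1 - p) * v - u powr p * v powr (1 - p)"
  proof (cases "p \<le> 1 / 2")
    case True
    then show ?thesis using arith_geo_mean_gap_half[of p u v] p uv by (simp add: min_def)
  next
    case False
    then show ?thesis using arith_geo_mean_gap_half[of "1 - p" v u] p uv
      by (simp add: min_def power2_commute algebra_simps)
  qed
  have "(u - v)\<^sup>2 = (sqrt u - sqrt v)\<^sup>2 * (sqrt u + sqrt v)\<^sup>2"
    using sq by (simp flip: power_mult_distrib) (simp add: square_diff_square_factored power2_eq_square algebra_simps)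
  also have "\<dots> \<le> (sqrt u - sqrt v)\<^sup>2 * (2 * (u + v))"
  proof (rule mult_left_mono)
    have "0 \<le> (sqrt u - sqrt v)\<^sup>2" by simp
    then show "(sqrt u + sqrt v)\<^sup>2 \<le> 2 * (u + v)" using sq by (simp add: power2_sum power2_diff)
  qed simp
  finally have "min p (1 - p) * (u - v)\<^sup>2 \<le> min p (1 - p) * ((sqrt u - sqrt v)\<^sup>2 * (2 * (u + v)))"
    using p by (intro mult_left_mono) auto
  also have "\<dots> = 2 * (u + v) * (min p (1 - p) * (sqrt u - sqrt v)\<^sup>2)" by simp
  also have "\<dots> \<le> 2 * (u + v) * (p * u + (1 - p) * v - u powr p * v powr (1 - p))"
    using 1 uv by (intro mult_left_mono) auto
  finally show ?thesis .
qed

lemma mem_pow_cone: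
  "x \<in> pow_cone p \<longleftrightarrow> \<bar>x $ 3\<bar> \<le> x $ 1 powr p * x $ 2 powr (1 - p) \<and> 0 \<le> x $ 1 \<and> 0 \<le> x $ 2"
proof
  assume *: "\<bar>x $ 3\<bar> \<le> x $ 1 powr p * x $ 2 powr (1 - p) \<and> 0 \<le> x $ 1 \<and> 0 \<le> x $ 2"
  have "x = vector [x $ 1, x $ 2, x $ 3]" by (rule vec3_eqI) simp_all
  then show "x \<in> pow_cone p" unfolding pow_cone_def using * by blast
qed (auto simp: pow_cone_def)

text \<open>A normal of the tangent plane along the diagonal ray; diagonal scalings reduce every
  generic face to this one.\<close>

abbreviation pow_normal :: "real \<Rightarrow> real^3" where
  "pow_normal p \<equiv> vector [p, 1 - p, -1]"

context
  fixes p :: real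
  assumes p: "0 < p" "p < 1"
begin

lemma pow_normal_gap:
  assumes "x \<in> pow_cone p"
  shows "min p (1 - p) * (x $ 1 - x $ 2)\<^sup>2 \<le> 2 * (x $ 1 + x $ 2) * (pow_normal p \<bullet> x)"
    "0 \<le> pow_normal p \<bullet> x"
proof -
  have x: "\<bar>x $ 3\<bar> \<le> x $ 1 powr p * x $ 2 powr (1 - p)" "0 \<le> x $ 1" "0 \<le> x $ 2"
    using assms by (auto simp: mem_pow_cone)
  have "min p (1 - p) * (x $ 1 - x $ 2)\<^sup>2
      \<le> 2 * (x $ 1 + x $ 2) * (p * x $ 1 + (1 - p) * x $ 2 - x $ 1 powr p * x $ 2 powr (1 - p))"
    using p x by (intro arith_geo_mean_gap)
  also have "\<dots> \<le> 2 * (x $ 1 + x $ 2) * (pow_normal p \<bullet> x)"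
    using x by (intro mult_left_mono) (auto simp: inner_3)
  finally show "min p (1 - p) * (x $ 1 - x $ 2)\<^sup>2 \<le> 2 * (x $ 1 + x $ 2) * (pow_normal p \<bullet> x)" .
  show "0 \<le> pow_normal p \<bullet> x"
    using weighted_arith_geo_mean[OF p x(2,3)] x(1) by (simp add: inner_3)
qed

lemma diagonal_in_pow_normal_face:
  assumes "0 \<le> t"
  shows "vector [t, t, t] \<in> exposed_face (pow_cone p) (pow_normal p)"
  using assms by (simp add: exposed_face_def mem_pow_cone inner_3 algebra_simps flip: powr_add)

lemma exposed_face_pow_normal:
  "exposed_face (pow_cone p) (pow_normal p) = {t *\<^sub>R vector [1, 1, 1] | t. 0 \<le> t}"
proof
  show "exposed_face (pow_cone p) (pow_normal p) \<subseteq> {t *\<^sub>R vector [1, 1, 1] | t. 0 \<le> t}"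
  proof
    fix x assume "x \<in> exposed_face (pow_cone p) (pow_normal p)"
    then have x: "x \<in> pow_cone p" "pow_normal p \<bullet> x = 0" by (auto simp: exposed_face_def)
    then have "min p (1 - p) * (x $ 1 - x $ 2)\<^sup>2 \<le> 0" using pow_normal_gap(1)[OF x(1)] by simp
    then have "x $ 1 = x $ 2" using p by (auto simp: mult_le_0_iff min_def split: if_splits)
    moreover from this have "x $ 3 = x $ 2" using x(2) by (simp add: inner_3 algebra_simps)
    ultimately have "x = x $ 1 *\<^sub>R vector [1, 1, 1]" by (intro vec3_eqI) auto
    then show "x \<in> {t *\<^sub>R vector [1, 1, 1] | t. 0 \<le> t}" using x(1) by (auto simp: mem_pow_cone)
  qed
  have "t *\<^sub>R vector [1, 1, 1] = (vector [t, t, t] :: real^3)" for t by (rule vec3_eqI) simp_all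
  then show "{t *\<^sub>R vector [1, 1, 1] | t. 0 \<le> t} \<subseteq> exposed_face (pow_cone p) (pow_normal p)"
    using diagonal_in_pow_normal_face by auto
qed

lemma face_error_bound_pow_normal: "face_error_bound (pow_cone p) (pow_normal p)"
proof -
  define q where "q = min p (1 - p)"
  have q: "q > 0" using p by (simp add: q_def)
  show ?thesis
  proof (rule face_error_boundI[of "8 / q + 3"])
    show "0 \<le> 8 / q + 3" using q by simp
    fix x assume x: "x \<in> pow_cone p"
    define g where "g = pow_normal p \<bullet> x"
    \<comment> \<open>With the weighted mean as diagonal parameter, the first two differences are
      multiples of \<open>x $ 1 - x $ 2\<close> and the third is \<open>- g\<close>.\<close>
    define m where "m = p * x $ 1 + (1 - p) * x $ 2"
    have g: "g = m - x $ 3" by (simp add: g_def m_def inner_3)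
    have g0: "0 \<le> g" using pow_normal_gap(2)[OF x] by (simp add: g_def)
    have n: "\<bar>x $ i\<bar> \<le> norm x" for i by (rule component_le_norm_cart)
    have x0: "0 \<le> x $ 1" "0 \<le> x $ 2" using x by (auto simp: mem_pow_cone)
    have "q * (x $ 1 - x $ 2)\<^sup>2 \<le> 2 * (x $ 1 + x $ 2) * g"
      using pow_normal_gap(1)[OF x] by (simp add: q_def g_def)
    also have "\<dots> \<le> (4 * norm x) * g" using n[of 1] n[of 2] g0 by (intro mult_right_mono) auto
    finally have d: "(x $ 1 - x $ 2)\<^sup>2 \<le> 4 / q * (norm x * g)" using q by (simp add: field_simps)
    have "p * x $ 1 \<le> p * norm x" "(1 - p) * x $ 2 \<le> (1 - p) * norm x"
      using n[of 1] n[of 2] p by (auto intro: mult_left_mono)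
    then have "g \<le> 2 * norm x" using n[of 3] unfolding g m_def by (simp add: algebra_simps)
    then have gg: "g\<^sup>2 \<le> 2 * (norm x * g)" using mult_right_mono[OF _ g0] by (fastforce simp: power2_eq_square)
    have "vector [m, m, m] \<in> exposed_face (pow_cone p) (pow_normal p)"
      using p x0 by (intro diagonal_in_pow_normal_face) (simp add: m_def)
    moreover have "(norm (x - vector [m, m, m]))\<^sup>2 \<le> (8 / q + 3) * norm x * (pow_normal p \<bullet> x)"
    proof -
      have e: "x $ 1 - m = (1 - p) * (x $ 1 - x $ 2)" "x $ 2 - m = - p * (x $ 1 - x $ 2)" "x $ 3 - m = - g"
        unfolding g by (simp_all add: m_def algebra_simps)
      have "(norm (x - vector [m, m, m]))\<^sup>2
          = ((1 - p)\<^sup>2 + p\<^sup>2) * (x $ 1 - x $ 2)\<^sup>2 + g\<^sup>2"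
        by (simp add: norm_sq_3 e power_mult_distrib) (simp add: algebra_simps)
      also have "\<dots> \<le> 2 * (x $ 1 - x $ 2)\<^sup>2 + g\<^sup>2"
      proof -
        have "(1 - p)\<^sup>2 \<le> 1" "p\<^sup>2 \<le> 1" using p by (auto simp: power_le_one)
        then show ?thesis by (intro add_right_mono mult_right_mono) auto
      qed
      also have "\<dots> \<le> 2 * (4 / q * (norm x * g)) + 3 * (norm x * g)"
        using d gg mult_nonneg_nonneg[OF norm_ge_zero[of x] g0] by linarith
      also have "\<dots> = (8 / q + 3) * norm x * (pow_normal p \<bullet> x)"
        by (simp add: g_def algebra_simps)
      finally show ?thesis .
    qed
    ultimately show "\<exists>y\<in>exposed_face (pow_cone p) (pow_normal p).
        (norm (x - y))\<^sup>2 \<le> (8 / q + 3) * norm x * (pow_normal p \<bullet> x)" by blast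
  qed
qed

end

section \<open>Diagonal scalings and the dual of the power cone\<close>

definition diag3 :: "real \<Rightarrow> real \<Rightarrow> real \<Rightarrow> real^3 \<Rightarrow> real^3" where
  "diag3 a b c x = vector [a * x $ 1, b * x $ 2, c * x $ 3]"

lemma diag3_simps [simp]:
  "diag3 a b c x $ 1 = a * x $ 1" "diag3 a b c x $ 2 = b * x $ 2" "diag3 a b c x $ 3 = c * x $ 3"
  by (simp_all add: diag3_def)

lemma linear_diag3: "linear (diag3 a b c)"
  by (rule linearI) (auto intro!: vec3_eqI simp: algebra_simps)

lemma diag3_inverse:
  assumes "a \<noteq> 0" "b \<noteq> 0" "c \<noteq> 0"
  shows "diag3 a b c (diag3 (1 / a) (1 / b) (1 / c) x) = x"
    "diag3 (1 / a) (1 / b) (1 / c) (diag3 a b c x) = x"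
  by (rule vec3_eqI; use assms in simp)+

lemma inj_diag3: "a \<noteq> 0 \<Longrightarrow> b \<noteq> 0 \<Longrightarrow> c \<noteq> 0 \<Longrightarrow> inj (diag3 a b c)"
  by (rule inj_on_inverseI) (rule diag3_inverse(2))

lemma diag3_image_eq:
  assumes "a \<noteq> 0" "b \<noteq> 0" "c \<noteq> 0" "\<And>x. diag3 a b c x \<in> L \<longleftrightarrow> x \<in> K"
  shows "diag3 a b c ` K = L"
proof -
  have "x \<in> diag3 a b c ` K" if "x \<in> L" for x
    using that assms diag3_inverse(1)[OF assms(1-3), of x] by (metis image_eqI)
  then show ?thesis using assms(4) by auto
qed

text \<open>Sufficiency is the weighted mean inequality; necessity tests the point with first
  coordinates \<open>p / s $ 1\<close> and \<open>(1 - p) / s $ 2\<close>, where equality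
  holds.\<close>

lemma mem_dual_pow_cone:
  assumes p: "0 < p" "p < 1"
  shows "s \<in> dual_cone UNIV (pow_cone p) \<longleftrightarrow>
    \<bar>s $ 3\<bar> \<le> (s $ 1 / p) powr p * (s $ 2 / (1 - p)) powr (1 - p) \<and> 0 \<le> s $ 1 \<and> 0 \<le> s $ 2"
  (is "_ \<longleftrightarrow> ?R")
proof
  assume "s \<in> dual_cone UNIV (pow_cone p)"
  then have s: "0 \<le> s $ 1 * x $ 1 + s $ 2 * x $ 2 + s $ 3 * x $ 3" if "x \<in> pow_cone p" for x
    using that by (auto simp: dual_cone_def inner_3)
  have s1: "0 \<le> s $ 1" using s[of "vector [1, 0, 0]"] by (simp add: mem_pow_cone)
  have s2: "0 \<le> s $ 2" using s[of "vector [0, 1, 0]"] by (simp add: mem_pow_cone)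
  have test: "\<bar>s $ 3\<bar> * (u powr p * v powr (1 - p)) \<le> s $ 1 * u + s $ 2 * v"
    if "0 \<le> u" "0 \<le> v" for u v
    using s[of "vector [u, v, (if 0 \<le> s $ 3 then - 1 else 1) * (u powr p * v powr (1 - p))]"] that
    by (cases "0 \<le> s $ 3") (simp_all add: mem_pow_cone)
  have "\<bar>s $ 3\<bar> \<le> (s $ 1 / p) powr p * (s $ 2 / (1 - p)) powr (1 - p)"
  proof (cases "s $ 3 = 0")
    case False
    have "s $ 1 \<noteq> 0"
    proof
      assume "s $ 1 = 0"
      \<comment> \<open>The exponent \<open>1 / p\<close> is chosen so that the test reads
        \<open>s $ 2 + 1 \<le> s $ 2\<close>.\<close>
      then show False
        using test[of "((s $ 2 + 1) / \<bar>s $ 3\<bar>) powr (1 / p)" 1] False s2 p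
        by (simp add: powr_powr)
    qed
    moreover have "s $ 2 \<noteq> 0"
    proof
      assume "s $ 2 = 0"
      then show False
        using test[of 1 "((s $ 1 + 1) / \<bar>s $ 3\<bar>) powr (1 / (1 - p))"] False s1 p
        by (simp add: powr_powr)
    qed
    ultimately have pos: "0 < s $ 1" "0 < s $ 2" using s1 s2 by auto
    have "\<bar>s $ 3\<bar> * ((p / s $ 1) powr p * ((1 - p) / s $ 2) powr (1 - p)) \<le> 1"
      using test[of "p / s $ 1" "(1 - p) / s $ 2"] pos p by simp
    then show ?thesis using pos p by (simp add: powr_divide field_simps)
  qed simp
  then show ?R using s1 s2 by simp
next
  assume R: ?R
  have "0 \<le> s \<bullet> x" if "x \<in> pow_cone p" for x
  proof -
    have x: "\<bar>x $ 3\<bar> \<le> x $ 1 powr p * x $ 2 powr (1 - p)" "0 \<le> x $ 1" "0 \<le> x $ 2"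
      using that by (auto simp: mem_pow_cone)
    have "\<bar>s $ 3 * x $ 3\<bar> \<le> ((s $ 1 / p) powr p * (s $ 2 / (1 - p)) powr (1 - p))
        * (x $ 1 powr p * x $ 2 powr (1 - p))"
      unfolding abs_mult using R x by (intro mult_mono) auto
    also have "\<dots> = (s $ 1 / p * x $ 1) powr p * (s $ 2 / (1 - p) * x $ 2) powr (1 - p)"
      using R x p powr_mult[of "s $ 1 / p" "x $ 1" p] powr_mult[of "s $ 2 / (1 - p)" "x $ 2" "1 - p"]
      by (simp add: mult_ac)
    also have "\<dots> \<le> p * (s $ 1 / p * x $ 1) + (1 - p) * (s $ 2 / (1 - p) * x $ 2)"
      using R x p by (intro weighted_arith_geo_mean) auto
    also have "\<dots> = s $ 1 * x $ 1 + s $ 2 * x $ 2" using p by simp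
    finally show ?thesis by (simp add: inner_3)
  qed
  then show "s \<in> dual_cone UNIV (pow_cone p)" by (simp add: dual_cone_def)
qed

text \<open>The equation in \<open>pow_param\<close> makes the geometric mean scale by
  \<open>1 / \<bar>c\<bar>\<close>, in step with the third coordinate.\<close>

lemma diag3_pow_cone:
  assumes "pow_param p a c"
  shows "diag3 (p / a) 1 (- 1 / c) ` pow_cone p = pow_cone p"
proof (rule diag3_image_eq)
  have p: "0 < p" "p < 1" "a > 0" "c \<noteq> 0" "\<bar>c\<bar> = (a / p) powr p"
    using assms by (auto simp: pow_param_def)
  show "p / a \<noteq> 0" "(1::real) \<noteq> 0" "- 1 / c \<noteq> 0" using p by auto
  show "diag3 (p / a) 1 (- 1 / c) x \<in> pow_cone p \<longleftrightarrow> x \<in> pow_cone p" for x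
  proof -
    have "\<bar>c\<bar> > 0" using p by simp
    then have "\<bar>x $ 3\<bar> / \<bar>c\<bar> \<le> (x $ 1 powr p / \<bar>c\<bar>) * x $ 2 powr (1 - p)
        \<longleftrightarrow> \<bar>x $ 3\<bar> \<le> x $ 1 powr p * x $ 2 powr (1 - p)"
      by (simp add: divide_le_cancel)
    moreover have "(p / a * x $ 1) powr p = x $ 1 powr p / \<bar>c\<bar>" if "0 \<le> x $ 1"
      using p that by (simp add: powr_mult powr_divide)
    moreover have "0 \<le> p / a * x $ 1 \<longleftrightarrow> 0 \<le> x $ 1" using p by (simp add: zero_le_mult_iff zero_le_divide_iff)
    ultimately show ?thesis by (auto simp: mem_pow_cone abs_mult)
  qed
qed

text \<open>The factor \<open>1 - p\<close> cancels a division in the description of the dual, and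
  \<open>(a / p) powr p = \<bar>c\<bar>\<close> matches the third coordinate; the dual is thus a
  diagonal image of the cone itself.\<close>

lemma diag3_dual_pow_cone:
  assumes "pow_param p a c"
  shows "diag3 a (1 - p) c ` pow_cone p = dual_cone UNIV (pow_cone p)"
proof (rule diag3_image_eq)
  have p: "0 < p" "p < 1" "a > 0" "c \<noteq> 0" "\<bar>c\<bar> = (a / p) powr p"
    using assms by (auto simp: pow_param_def)
  show "a \<noteq> 0" "1 - p \<noteq> 0" "c \<noteq> 0" using p by auto
  show "diag3 a (1 - p) c x \<in> dual_cone UNIV (pow_cone p) \<longleftrightarrow> x \<in> pow_cone p" for x
  proof -
    have "\<bar>c\<bar> > 0" using p by simp
    then have "\<bar>c\<bar> * \<bar>x $ 3\<bar> \<le> (\<bar>c\<bar> * x $ 1 powr p) * x $ 2 powr (1 - p)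
        \<longleftrightarrow> \<bar>x $ 3\<bar> \<le> x $ 1 powr p * x $ 2 powr (1 - p)"
      by (simp add: mult.assoc)
    moreover have "(a * x $ 1 / p) powr p = \<bar>c\<bar> * x $ 1 powr p" if "0 \<le> x $ 1"
      using p that powr_mult[of "a / p" "x $ 1" p] by simp
    moreover have "0 \<le> a * x $ 1 \<longleftrightarrow> 0 \<le> x $ 1" "0 \<le> (1 - p) * x $ 2 \<longleftrightarrow> 0 \<le> x $ 2"
      using p by (simp_all add: zero_le_mult_iff)
    ultimately show ?thesis using p by (auto simp: mem_dual_pow_cone mem_pow_cone abs_mult)
  qed
qed

lemma linear_image_ray:
  assumes "linear f"
  shows "f ` {t *\<^sub>R x | t. 0 \<le> t} = {t *\<^sub>R f x | t. 0 \<le> t}"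
  using linear_scale[OF assms] by (auto simp: image_iff) metis

text \<open>The scaling maps (1, 1, 1) to \<open>pow_ray p a c\<close> and pulls
  \<open>pow_sigma p a c\<close> back to \<open>pow_normal p\<close>.\<close>

lemma
  assumes "pow_param p a c"
  shows exposed_face_pow_cone:
      "exposed_face (pow_cone p) (pow_sigma p a c) = {t *\<^sub>R pow_ray p a c | t. 0 \<le> t}"
    and face_error_bound_pow_cone: "face_error_bound (pow_cone p) (pow_sigma p a c)"
proof -
  have p: "0 < p" "p < 1" "a > 0" "c \<noteq> 0" using assms by (auto simp: pow_param_def)
  let ?f = "diag3 (p / a) 1 (- 1 / c)"
  have s: "pow_sigma p a c \<bullet> ?f x = 1 * (pow_normal p \<bullet> x)" for x
    using p by (simp add: pow_sigma_def inner_3)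
  have "?f (vector [1, 1, 1]) = pow_ray p a c" by (rule vec3_eqI) (simp_all add: pow_ray_def)
  then show "exposed_face (pow_cone p) (pow_sigma p a c) = {t *\<^sub>R pow_ray p a c | t. 0 \<le> t}"
    using exposed_face_image[of 1 "pow_cone p" "pow_sigma p a c" ?f "pow_normal p"] s
    by (simp add: diag3_pow_cone[OF assms, simplified] exposed_face_pow_normal p linear_image_ray linear_diag3)
  have "face_error_bound (?f ` pow_cone p) (pow_sigma p a c)"
    by (rule face_error_bound_bij_3[OF face_error_bound_pow_normal linear_diag3 inj_diag3 _ s])
      (use p pow_normal_gap in auto)
  then show "face_error_bound (pow_cone p) (pow_sigma p a c)" by (simp only: diag3_pow_cone[OF assms])
qed

text \<open>The roles are exchanged: (1, 1, 1) goes to \<open>pow_sigma p a c\<close>, and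
  \<open>pow_ray p a c\<close> pulls back to \<open>pow_normal p\<close>.\<close>

lemma
  assumes "pow_param p a c" "t > 0"
  shows exposed_face_dual_pow_cone:
      "exposed_face (dual_cone UNIV (pow_cone p)) (t *\<^sub>R pow_ray p a c)
        = {t' *\<^sub>R pow_sigma p a c | t'. 0 \<le> t'}"
    and face_error_bound_dual_pow_cone:
      "face_error_bound (dual_cone UNIV (pow_cone p)) (t *\<^sub>R pow_ray p a c)"
proof -
  have p: "0 < p" "p < 1" "a > 0" "c \<noteq> 0" using assms by (auto simp: pow_param_def)
  let ?f = "diag3 a (1 - p) c"
  have s: "t *\<^sub>R pow_ray p a c \<bullet> ?f x = t * (pow_normal p \<bullet> x)" for x
    using p by (simp add: pow_ray_def inner_3 algebra_simps)
  have "?f (vector [1, 1, 1]) = pow_sigma p a c" by (rule vec3_eqI) (simp_all add: pow_sigma_def)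
  then show "exposed_face (dual_cone UNIV (pow_cone p)) (t *\<^sub>R pow_ray p a c)
        = {t' *\<^sub>R pow_sigma p a c | t'. 0 \<le> t'}"
    using exposed_face_image[OF _ s, of "pow_cone p"] assms(2)
    by (simp add: diag3_dual_pow_cone[OF assms(1)] exposed_face_pow_normal p linear_image_ray linear_diag3)
  have "face_error_bound (?f ` pow_cone p) (t *\<^sub>R pow_ray p a c)"
    by (rule face_error_bound_bij_3[OF face_error_bound_pow_normal linear_diag3 inj_diag3 _ s])
      (use p assms pow_normal_gap in auto)
  then show "face_error_bound (dual_cone UNIV (pow_cone p)) (t *\<^sub>R pow_ray p a c)"
    by (simp only: diag3_dual_pow_cone[OF assms(1)])
qed

lemma face_error_bound_listed_3d:
  assumes "listed_3d K s"
  shows "face_error_bound K s"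
proof -
  have s: "s \<in> dual_cone UNIV K" using assms by (simp add: listed_3d_def cone_setting_def)
  consider "K = exp_cone" "strictly_complementary UNIV K s"
    | "K = dual_cone UNIV exp_cone" "strictly_complementary UNIV K s"
    | p a c where "pow_param p a c" "K = pow_cone p" "s = pow_sigma p a c"
    | p a c t where "pow_param p a c" "t > 0" "K = dual_cone UNIV (pow_cone p)"
      "s = t *\<^sub>R pow_ray p a c"
    using assms unfolding listed_3d_def by blast
  then show ?thesis
  proof cases
    case 1
    then show ?thesis
      using s face_error_bound_exp_cone not_strictly_complementary_exp_cone by blast
  next
    case 2
    then show ?thesis
      using s face_error_bound_dual_exp_cone not_strictly_complementary_dual_exp_cone by blast
  next
    case 3
    then show ?thesis using face_error_bound_pow_cone by blast
  next
    case 4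
    then show ?thesis using face_error_bound_dual_pow_cone by blast
  qed
qed

section \<open>Assembly of the cases and the product\<close>

theorem mainTheorem4:
  shows "(\<forall>(I :: 'n::finite set) K s. listed_vec I K s \<longrightarrow> qfv K s)
    \<and> (\<forall>(I :: 'n set) K s. listed_sym I K s \<longrightarrow> qfv K s)
    \<and> (\<forall>K s. listed_3d K s \<longrightarrow> qfv K s)
    \<and> (\<forall>p a c. pow_param p a c \<longrightarrow>
         exposed_face (pow_cone p) (pow_sigma p a c) = {t *\<^sub>R pow_ray p a c | t. t \<ge> 0})
    \<and> (\<forall>p a c t. pow_param p a c \<and> t > 0 \<longrightarrow>
         exposed_face (dual_cone UNIV (pow_cone p)) (t *\<^sub>R pow_ray p a c)
           = {t' *\<^sub>R pow_sigma p a c | t'. t' \<ge> 0})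
    \<and> (\<forall>(K :: 'q::finite \<Rightarrow> 'a::euclidean_space set) (s :: 'a^'q).
         (\<forall>i. (\<exists>(I :: 'n set) K0 s0. listed_vec I K0 s0
                  \<and> isometric_copy (vec_space I) K0 s0 (K i) (s $ i))
            \<or> (\<exists>(I :: 'n set) K0 s0. listed_sym I K0 s0
                  \<and> isometric_copy (sym_space I) K0 s0 (K i) (s $ i))
            \<or> (\<exists>K0 s0. listed_3d K0 s0
                  \<and> isometric_copy UNIV K0 s0 (K i) (s $ i)))
         \<longrightarrow> exposed_face (cart_prod K) s = cart_prod (\<lambda>i. exposed_face (K i) (s $ i))
             \<and> qfv (cart_prod K) s)"
proof (intro conjI allI impI)
  fix I :: "'n set" and K and s :: "real^'n"
  assume l: "listed_vec I K s"
  then have "cone_setting (vec_space I) K s" by (simp add: listed_vec_def)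
  then show "qfv K s" using face_error_bound_listed_vec[OF l] by (rule qfv_if_cone_setting)
next
  fix I :: "'n set" and K and s :: "real^'n^'n"
  assume l: "listed_sym I K s"
  then have "cone_setting (sym_space I) K s" unfolding listed_sym_def by blast
  then show "qfv K s" using face_error_bound_listed_sym[OF l] by (rule qfv_if_cone_setting)
next
  fix K s
  assume l: "listed_3d K s"
  then have "cone_setting UNIV K s" by (simp add: listed_3d_def)
  then show "qfv K s" using face_error_bound_listed_3d[OF l] by (rule qfv_if_cone_setting)
next
  fix p a c
  assume "pow_param p a c"
  then show "exposed_face (pow_cone p) (pow_sigma p a c) = {t *\<^sub>R pow_ray p a c | t. t \<ge> 0}"
    by (rule exposed_face_pow_cone)
next
  fix p a c t :: real
  assume "pow_param p a c \<and> t > 0"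
  then show "exposed_face (dual_cone UNIV (pow_cone p)) (t *\<^sub>R pow_ray p a c)
      = {t' *\<^sub>R pow_sigma p a c | t'. t' \<ge> 0}"
    using exposed_face_dual_pow_cone by blast
next
  fix K :: "'q \<Rightarrow> 'a set" and s :: "'a^'q"
  assume *: "\<forall>i. (\<exists>(I :: 'n set) K0 s0. listed_vec I K0 s0
        \<and> isometric_copy (vec_space I) K0 s0 (K i) (s $ i))
      \<or> (\<exists>(I :: 'n set) K0 s0. listed_sym I K0 s0
        \<and> isometric_copy (sym_space I) K0 s0 (K i) (s $ i))
      \<or> (\<exists>K0 s0. listed_3d K0 s0 \<and> isometric_copy UNIV K0 s0 (K i) (s $ i))"
  \<comment> \<open>The factors pass on the homogeneous bound, not \<open>qfv\<close>, together with
    nonnegativity: these are what the product argument combines.\<close>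
  have factor: "face_error_bound (K i) (s $ i) \<and> (\<forall>x\<in>K i. 0 \<le> s $ i \<bullet> x)" for i
  proof -
    consider (vec) I K0 s0 where "listed_vec (I :: 'n set) K0 s0"
        "isometric_copy (vec_space I) K0 s0 (K i) (s $ i)"
      | (sym) I K0 s0 where "listed_sym (I :: 'n set) K0 s0"
        "isometric_copy (sym_space I) K0 s0 (K i) (s $ i)"
      | (dim3) K0 s0 where "listed_3d K0 s0" "isometric_copy UNIV K0 s0 (K i) (s $ i)"
      using * by blast
    then show ?thesis
    proof cases
      case vec
      then have "cone_setting (vec_space I) K0 s0" by (simp add: listed_vec_def)
      then show ?thesis
        using face_error_bound_isometric_copy[OF vec(2) face_error_bound_listed_vec[OF vec(1)]]
        by (simp add: cone_setting_def)
    next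
      case sym
      then have "cone_setting (sym_space I) K0 s0" unfolding listed_sym_def by blast
      then show ?thesis
        using face_error_bound_isometric_copy[OF sym(2) face_error_bound_listed_sym[OF sym(1)]]
        by (simp add: cone_setting_def)
    next
      case dim3
      then have "cone_setting UNIV K0 s0" by (simp add: listed_3d_def)
      then show ?thesis
        using face_error_bound_isometric_copy[OF dim3(2) face_error_bound_listed_3d[OF dim3(1)]]
        by (simp add: cone_setting_def)
    qed
  qed
  then show "exposed_face (cart_prod K) s = cart_prod (\<lambda>i. exposed_face (K i) (s $ i))"
    by (intro exposed_face_cart_prod) blast
  have "face_error_bound (cart_prod K) s" using factor by (intro face_error_bound_cart_prod) auto
  moreover have "0 \<le> s \<bullet> x" if "x \<in> cart_prod K" for x
    using that factor by (auto simp: inner_vec_def cart_prod_def intro: sum_nonneg)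
  ultimately show "qfv (cart_prod K) s" by (rule qfv_if_face_error_bound)
qed

end
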